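(* Let $\mathcal M$ be a finite simple oriented matroid, with underlying matroid $M$ and tope graph $G$. Then $$\operatorname{Mag}(G;q)=Z_M(-1,q),$$ where the equality holds both in $\mathbb Z[[q]]$ (expanding the rational function $\operatorname{Mag}(G;q)$ at $q=0$) and as an equality of rational functions in $q$.
   Context: All matroids, oriented matroids and graphs are finite; $\mathbb N=\mathbb Z_{\ge 0}$. Oriented matroids. For sign vectors $X,Y\in\{+,0,-\}^E$ put $(X\circ Y)_e=X_e$ if $X_e\neq0$ and $Y_e$ otherwise, and $S(X,Y)=\{e:X_e=-Y_e\neq0\}$. An oriented matroid $\mathcal M=(E,\mathcal L)$ consists of a set of covectors $\mathcal L\subseteq\{+,0,-\}^E$ with (1) $0\in\mathcal L$; (2) $X\in\mathcal L\Rightarrow -X\in\mathcal L$; (3) $X,Y\in\mathcal L\Rightarrow X\circ Y\in\mathcal L$; (4) if $X,Y\in\mathcal L$ and $e\in S(X,Y)$ there is $Z\in\mathcal L$ with $Z_e=0$ and $Z_f=(X\circ Y)_f$ for all $f\notin S(X,Y)$. Its underlying matroid $M$ is the matroid on $E$ whose flats are exactly the zero sets $Z(X)=\{e:X_e=0\}$, $X\in\mathcal L$. $\mathcal M$ is simple if $M$ has no loops and no parallel elements. Covectors are ordered by $X\le Y$ iff $X_e\in\{0,Y_e\}$ for all $e$; topes are the maximal covectors (for loopless $M$: the covectors with no zero coordinate). The tope graph has the topes as vertices, two topes being adjacent when they cover a common covector; for simple $\mathcal M$ this means they differ in exactly one coordinate, and the graph distance is $d(B,C)=|S(B,C)|$.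 Magnitude. For a finite connected graph $G$ with shortest-path distance $d$, let $K_G(q)=(q^{d(B,C)})_{B,C\in V(G)}$, invertible over $\mathbb Q(q)$; then $\operatorname{Mag}(G;q)=\mathbf 1^{\mathsf T}K_G(q)^{-1}\mathbf 1$, a rational function regular at $0$. Motivic zeta function. For a matroid $M$ on $E$ with rank function $r_M$ and $r(M)=r_M(E)$, $\chi_M(x)=\sum_{S\subseteq E}(-1)^{|S|}x^{r(M)-r_M(S)}$. For $w\in\mathbb N^E$ put $|w|=\sum_e w_e$ and $\operatorname{wt}_M(w)=\max_B\sum_{e\in B}w_e$ over bases $B$ of $M$; the bases attaining the maximum are the bases of the initial matroid $M_w$ on $E$. Then $$Z_M(x,T)=\sum_{w\in\mathbb N^E}\chi_{M_w}(x)\,x^{-r(M)-\operatorname{wt}_M(w)}\,T^{|w|}\in\mathbb Z[x^{\pm1}][[T]],$$ and $Z_M(-1,q)\in\mathbb Z[[q]]$ is obtained by substituting $x=-1$ coefficientwise and $T=q$. *)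

theory Defs
  imports
    "HOL-Computational_Algebra.Computational_Algebra"
    "HOL-Computational_Algebra.Field_as_Ring"
    "HOL-Library.Poly_Mapping"
begin

text \<open>A matroid on \<open>E\<close> is represented by its family \<open>I\<close> of independent sets.\<close>

locale matroid =
  fixes E :: "'a set" and I :: "'a set set"
  assumes finite_ground: "finite E"
    and indep_subset: "A \<in> I \<Longrightarrow> A \<subseteq> E"
    and indep_empty: "{} \<in> I"
    and indep_mono: "B \<in> I \<Longrightarrow> A \<subseteq> B \<Longrightarrow> A \<in> I"
    and augment: "A \<in> I \<Longrightarrow> B \<in> I \<Longrightarrow> card A < card B \<Longrightarrow> \<exists>e\<in>B - A. insert e A \<in> I"

definition matroid_rank :: "'a set set \<Rightarrow> 'a set \<Rightarrow> nat" where
  "matroid_rank I S = Max {card A | A. A \<in> I \<and> A \<subseteq> S}"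

definition matroid_bases :: "'a set set \<Rightarrow> 'a set set" where
  "matroid_bases I = {B \<in> I. \<forall>A\<in>I. B \<subseteq> A \<longrightarrow> A = B}"

definition matroid_flats :: "'a set \<Rightarrow> 'a set set \<Rightarrow> 'a set set" where
  "matroid_flats E I =
    {F. F \<subseteq> E \<and> (\<forall>e\<in>E - F. matroid_rank I F < matroid_rank I (insert e F))}"

definition matroid_loop :: "'a set set \<Rightarrow> 'a \<Rightarrow> bool" where
  "matroid_loop I e \<longleftrightarrow> {e} \<notin> I"

definition matroid_parallel :: "'a set set \<Rightarrow> 'a \<Rightarrow> 'a \<Rightarrow> bool" where
  "matroid_parallel I e f \<longleftrightarrow>
    e \<noteq> f \<and> \<not> matroid_loop I e \<and> \<not> matroid_loop I f \<and> {e, f} \<notin> I"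

definition matroid_simple :: "'a set \<Rightarrow> 'a set set \<Rightarrow> bool" where
  "matroid_simple E I \<longleftrightarrow>
    (\<forall>e\<in>E. \<not> matroid_loop I e) \<and> (\<forall>e\<in>E. \<forall>f\<in>E. \<not> matroid_parallel I e f)"

text \<open>Evaluated at a ring element \<open>x\<close>; truncated subtraction is harmless, since
  \<open>matroid_rank\<close> is monotone.\<close>

definition matroid_chi :: "'a set \<Rightarrow> 'a set set \<Rightarrow> 'b::comm_ring_1 \<Rightarrow> 'b" where
  "matroid_chi E I x =
    (\<Sum>S\<in>Pow E. (-1) ^ card S * x ^ (matroid_rank I E - matroid_rank I S))"

definition matroid_wt :: "'a set set \<Rightarrow> ('a \<Rightarrow> nat) \<Rightarrow> nat" where
  "matroid_wt I w = Max ((\<lambda>B. \<Sum>e\<in>B. w e) ` matroid_bases I)"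

definition initial_matroid :: "'a set set \<Rightarrow> ('a \<Rightarrow> nat) \<Rightarrow> 'a set set" where
  "initial_matroid I w =
    {A. \<exists>B\<in>matroid_bases I. (\<Sum>e\<in>B. w e) = matroid_wt I w \<and> A \<subseteq> B}"

text \<open>Laurent polynomials with integer coefficients: the group ring of the integers, where
  \<open>Poly_Mapping.single k c\<close> is the monomial \<open>c x\<^sup>k\<close>.\<close>

type_synonym int_laurent = "int \<Rightarrow>\<^sub>0 int"

definition laurent_x_pow :: "int \<Rightarrow> int_laurent" where
  "laurent_x_pow k = Poly_Mapping.single k 1"

text \<open>A vector \<open>w\<close> of naturals indexed by \<open>E\<close> is a function that vanishes outside \<open>E\<close>;
  only finitely many of them have a given sum.\<close>

definition motivic_zeta :: "'a set \<Rightarrow> 'a set set \<Rightarrow> int_laurent fps" where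
  "motivic_zeta E I = Abs_fps (\<lambda>n.
    \<Sum>w | (\<forall>e. e \<notin> E \<longrightarrow> w e = 0) \<and> (\<Sum>e\<in>E. w e) = n.
      matroid_chi E (initial_matroid I w) (laurent_x_pow 1) *
      laurent_x_pow (- int (matroid_rank I E) - int (matroid_wt I w)))"

definition laurent_at_minus_one :: "int_laurent \<Rightarrow> int" where
  "laurent_at_minus_one p =
    (\<Sum>k\<in>Poly_Mapping.keys p.
      Poly_Mapping.lookup p k * (if even k then 1 else -1))"

definition motivic_zeta_minus_one :: "'a set \<Rightarrow> 'a set set \<Rightarrow> int fps" where
  "motivic_zeta_minus_one E I =
    Abs_fps (\<lambda>n. laurent_at_minus_one (fps_nth (motivic_zeta E I) n))"

text \<open>Sign vectors on \<open>E\<close> are functions with values in \<open>{-1, 0, 1}\<close> that vanish outside \<open>E\<close>.\<close>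

definition sign_vectors :: "'a set \<Rightarrow> ('a \<Rightarrow> int) set" where
  "sign_vectors E = {X. (\<forall>e\<in>E. X e \<in> {-1, 0, 1}) \<and> (\<forall>e. e \<notin> E \<longrightarrow> X e = 0)}"

definition sign_comp :: "('a \<Rightarrow> int) \<Rightarrow> ('a \<Rightarrow> int) \<Rightarrow> 'a \<Rightarrow> int" where
  "sign_comp X Y = (\<lambda>e. if X e \<noteq> 0 then X e else Y e)"

definition separation :: "('a \<Rightarrow> int) \<Rightarrow> ('a \<Rightarrow> int) \<Rightarrow> 'a set" where
  "separation X Y = {e. X e = - Y e \<and> X e \<noteq> 0}"

definition zero_set :: "'a set \<Rightarrow> ('a \<Rightarrow> int) \<Rightarrow> 'a set" where
  "zero_set E X = {e \<in> E. X e = 0}"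

locale oriented_matroid =
  fixes E :: "'a set" and L :: "('a \<Rightarrow> int) set"
  assumes finite_ground: "finite E"
    and covectors_subset: "L \<subseteq> sign_vectors E"
    and zero_covector: "(\<lambda>_. 0) \<in> L"
    and uminus_covector: "X \<in> L \<Longrightarrow> (\<lambda>e. - X e) \<in> L"
    and comp_covector: "X \<in> L \<Longrightarrow> Y \<in> L \<Longrightarrow> sign_comp X Y \<in> L"
    and elimination: "X \<in> L \<Longrightarrow> Y \<in> L \<Longrightarrow> e \<in> separation X Y \<Longrightarrow>
      \<exists>Z\<in>L. Z e = 0 \<and> (\<forall>f\<in>E - separation X Y. Z f = sign_comp X Y f)"

definition underlying_matroid :: "'a set \<Rightarrow> ('a \<Rightarrow> int) set \<Rightarrow> 'a set set" where
  "underlying_matroid E L = (THE I. matroid E I \<and> matroid_flats E I = zero_set E ` L)"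

text \<open>Such a matroid exists and is unique; this is proved at the end of the theory.\<close>

definition oriented_matroid_simple :: "'a set \<Rightarrow> ('a \<Rightarrow> int) set \<Rightarrow> bool" where
  "oriented_matroid_simple E L \<longleftrightarrow> matroid_simple E (underlying_matroid E L)"

definition covector_le :: "('a \<Rightarrow> int) \<Rightarrow> ('a \<Rightarrow> int) \<Rightarrow> bool" where
  "covector_le X Y \<longleftrightarrow> (\<forall>e. X e \<in> {0, Y e})"

definition topes :: "('a \<Rightarrow> int) set \<Rightarrow> ('a \<Rightarrow> int) set" where
  "topes L = {X \<in> L. \<forall>Y\<in>L. covector_le X Y \<longrightarrow> Y = X}"

text \<open>\<open>covector_covers L X Y\<close> means that \<open>X\<close> covers \<open>Y\<close> in the poset of covectors.\<close>

definition covector_covers ::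
  "('a \<Rightarrow> int) set \<Rightarrow> ('a \<Rightarrow> int) \<Rightarrow> ('a \<Rightarrow> int) \<Rightarrow> bool" where
  "covector_covers L X Y \<longleftrightarrow> X \<in> L \<and> Y \<in> L \<and> covector_le Y X \<and> Y \<noteq> X \<and>
    (\<forall>Z\<in>L. covector_le Y Z \<and> covector_le Z X \<longrightarrow> Z = Y \<or> Z = X)"

definition tope_adjacency :: "('a \<Rightarrow> int) set \<Rightarrow> (('a \<Rightarrow> int) \<times> ('a \<Rightarrow> int)) set" where
  "tope_adjacency L = {(B, C). B \<in> topes L \<and> C \<in> topes L \<and> B \<noteq> C \<and>
    (\<exists>X\<in>L. covector_covers L B X \<and> covector_covers L C X)}"

text \<open>A graph is given by its vertex set \<open>V\<close> and its symmetric adjacency relation \<open>R\<close>.\<close>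

definition graph_dist :: "('v \<times> 'v) set \<Rightarrow> 'v \<Rightarrow> 'v \<Rightarrow> nat" where
  "graph_dist R u v = (LEAST n. (u, v) \<in> R ^^ n)"

text \<open>The field of rational functions in \<open>q\<close> over the rationals is \<open>rat poly fract\<close>.\<close>

definition ratfun_q :: "rat poly fract" where
  "ratfun_q = Fract [:0, 1:] 1"

definition magnitude_matrix :: "('v \<times> 'v) set \<Rightarrow> 'v \<Rightarrow> 'v \<Rightarrow> rat poly fract" where
  "magnitude_matrix R u v = ratfun_q ^ graph_dist R u v"

text \<open>The two-sided inverse of a matrix with rows and columns indexed by \<open>V\<close>; entries outside
  \<open>V\<close> are set to 0 to make the inverse unique as a function.\<close>

definition is_inverse_on :: "'v set \<Rightarrow> ('v \<Rightarrow> 'v \<Rightarrow> 'b::field) \<Rightarrow> ('v \<Rightarrow> 'v \<Rightarrow> 'b) \<Rightarrow> bool" where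
  "is_inverse_on V K N \<longleftrightarrow>
    (\<forall>u v. u \<notin> V \<or> v \<notin> V \<longrightarrow> N u v = 0) \<and>
    (\<forall>u\<in>V. \<forall>v\<in>V. (\<Sum>t\<in>V. K u t * N t v) = (if u = v then 1 else 0)) \<and>
    (\<forall>u\<in>V. \<forall>v\<in>V. (\<Sum>t\<in>V. N u t * K t v) = (if u = v then 1 else 0))"

definition inverse_on :: "'v set \<Rightarrow> ('v \<Rightarrow> 'v \<Rightarrow> 'b::field) \<Rightarrow> 'v \<Rightarrow> 'v \<Rightarrow> 'b" where
  "inverse_on V K = (THE N. is_inverse_on V K N)"

definition magnitude :: "'v set \<Rightarrow> ('v \<times> 'v) set \<Rightarrow> rat poly fract" where
  "magnitude V R = (\<Sum>u\<in>V. \<Sum>v\<in>V. inverse_on V (magnitude_matrix R) u v)"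

text \<open>\<open>quot_of_fract\<close> returns numerator and denominator in lowest terms.\<close>

definition regular_at_0 :: "rat poly fract \<Rightarrow> bool" where
  "regular_at_0 F \<longleftrightarrow> poly (snd (quot_of_fract F)) 0 \<noteq> 0"

definition ratfun_expansion :: "rat poly fract \<Rightarrow> rat fps" where
  "ratfun_expansion F =
    fps_of_poly (fst (quot_of_fract F)) / fps_of_poly (snd (quot_of_fract F))"

definition ratfun_of_fps :: "rat fps \<Rightarrow> rat poly fract" where
  "ratfun_of_fps f = (THE F. regular_at_0 F \<and> ratfun_expansion F = f)"

definition rat_fps_of_int_fps :: "int fps \<Rightarrow> rat fps" where
  "rat_fps_of_int_fps f = Abs_fps (\<lambda>n. of_int (fps_nth f n))"

context matroid
begin

lemma finite_I: "finite I"
  using finite_ground indep_subset by (meson finite_Pow_iff finite_subset PowI subsetI)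

lemma rank_fin: "finite {card A | A. A \<in> I \<and> A \<subseteq> S}"
  using finite_I by (auto intro: finite_subset[of _ "card ` I"])

lemma card_le_rank: "A \<in> I \<Longrightarrow> A \<subseteq> S \<Longrightarrow> card A \<le> matroid_rank I S"
  unfolding matroid_rank_def by (rule Max_ge[OF rank_fin]) auto

lemma ex_rank: "\<exists>A\<in>I. A \<subseteq> S \<and> card A = matroid_rank I S"
proof -
  have "matroid_rank I S \<in> {card A | A. A \<in> I \<and> A \<subseteq> S}"
    unfolding matroid_rank_def by (rule Max_in[OF rank_fin]) (use indep_empty in auto)
  then show ?thesis by auto
qed

lemma fin_indep: "A \<in> I \<Longrightarrow> finite A"
  using finite_ground indep_subset finite_subset by blast

lemma extend:
  assumes "A \<in> I" "A \<subseteq> S"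
  shows "\<exists>C\<in>I. A \<subseteq> C \<and> C \<subseteq> S \<and> card C = matroid_rank I S"
  using assms
proof (induction "matroid_rank I S - card A" arbitrary: A rule: less_induct)
  case less
  show ?case
  proof (cases "card A = matroid_rank I S")
    case True then show ?thesis using less.prems by blast
  next
    case False
    then have lt: "card A < matroid_rank I S" using card_le_rank[OF less.prems] by simp
    obtain B where B: "B \<in> I" "B \<subseteq> S" "card B = matroid_rank I S" using ex_rank by blast
    then obtain e where e: "e \<in> B - A" "insert e A \<in> I" using augment[OF less.prems(1), of B] lt by auto
    have "card (insert e A) = Suc (card A)" using e fin_indep less(2) by simp
    then have "matroid_rank I S - card (insert e A) < matroid_rank I S - card A" using lt by simp
    from less(1)[OF this e(2)] e B less(3) show ?thesis by blast
  qed
qed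

lemma rank_indep: "A \<in> I \<Longrightarrow> matroid_rank I A = card A"
  by (metis card_le_rank card_mono ex_rank fin_indep order_antisym subset_refl)

lemma rank_mono: "S \<subseteq> T \<Longrightarrow> matroid_rank I S \<le> matroid_rank I T"
  by (metis card_le_rank ex_rank order_trans)

lemma indep_iff_flats:
  assumes "A \<subseteq> E"
  shows "A \<in> I \<longleftrightarrow> (\<forall>e\<in>A. \<exists>F\<in>matroid_flats E I. A - {e} \<subseteq> F \<and> e \<notin> F)"
proof
  assume A: "A \<in> I"
  show "\<forall>e\<in>A. \<exists>F\<in>matroid_flats E I. A - {e} \<subseteq> F \<and> e \<notin> F"
  proof
    fix e assume e: "e \<in> A"
    let ?D = "A - {e}"
    define F where "F = {f \<in> E. matroid_rank I (insert f ?D) = card ?D}"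
    have D: "?D \<in> I" using A indep_mono by blast
    have sub: "?D \<subseteq> F"
      using assms rank_indep[OF D] by (auto simp: F_def insert_absorb)
    have out: "insert f ?D \<in> I" if "f \<in> E" "f \<notin> F" for f
    proof -
      have "matroid_rank I (insert f ?D) \<noteq> card ?D" using that by (simp add: F_def)
      moreover obtain C where C: "C \<in> I" "?D \<subseteq> C" "C \<subseteq> insert f ?D"
          "card C = matroid_rank I (insert f ?D)"
        using extend[OF D] by blast
      ultimately have "C \<noteq> ?D" by auto
      then have "C = insert f ?D" using C(2,3) by blast
      then show ?thesis using C by simp
    qed
    have eF: "e \<notin> F"
    proof
      assume "e \<in> F"
      then have "matroid_rank I A = card ?D" using e by (simp add: F_def insert_absorb)
      moreover have "card ?D < card A" by (rule card_Diff1_less[OF fin_indep[OF A] e])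
      ultimately show False using rank_indep[OF A] by simp
    qed
    have rF: "matroid_rank I F = card ?D"
    proof -
      obtain C where C: "C \<in> I" "?D \<subseteq> C" "C \<subseteq> F" "card C = matroid_rank I F"
        using extend[OF D sub] by blast
      have "C = ?D"
      proof (rule ccontr)
        assume "C \<noteq> ?D"
        then obtain c where c: "c \<in> C" "c \<notin> ?D" using C by blast
        then have "insert c ?D \<in> I" using C indep_mono by (metis insert_subset)
        then have "matroid_rank I (insert c ?D) = Suc (card ?D)"
          using rank_indep c fin_indep[OF D] by simp
        then show False using c C by (auto simp: F_def)
      qed
      then show ?thesis using C by simp
    qed
    have "F \<in> matroid_flats E I"
      unfolding matroid_flats_def
    proof (safe)
      fix f assume "f \<in> F" then show "f \<in> E" by (simp add: F_def)
    next
      fix f assume f: "f \<in> E" "f \<notin> F"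
      have "insert f ?D \<subseteq> insert f F" using sub by blast
      then have "card (insert f ?D) \<le> matroid_rank I (insert f F)"
        using card_le_rank[OF out[OF f]] by blast
      moreover have "f \<notin> ?D" using sub f by blast
      ultimately show "matroid_rank I F < matroid_rank I (insert f F)"
        using rF fin_indep[OF D] by simp
    qed
    then show "\<exists>F\<in>matroid_flats E I. A - {e} \<subseteq> F \<and> e \<notin> F" using sub eF by blast
  qed
next
  assume R: "\<forall>e\<in>A. \<exists>F\<in>matroid_flats E I. A - {e} \<subseteq> F \<and> e \<notin> F"
  obtain B where B: "B \<in> I" "B \<subseteq> A" "card B = matroid_rank I A" using ex_rank by blast
  have "B = A"
  proof (rule ccontr)
    assume "B \<noteq> A"
    then obtain e where e: "e \<in> A" "e \<notin> B" using B by blast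
    then obtain F where F: "F \<in> matroid_flats E I" "A - {e} \<subseteq> F" "e \<notin> F" using R by blast
    then have BF: "B \<subseteq> F" using B e by blast
    then obtain C where C: "C \<in> I" "B \<subseteq> C" "C \<subseteq> F" "card C = matroid_rank I F"
      using extend[OF B(1)] by blast
    have lt: "matroid_rank I F < matroid_rank I (insert e F)"
      using F e assms by (auto simp: matroid_flats_def)
    obtain C' where C': "C' \<in> I" "C \<subseteq> C'" "C' \<subseteq> insert e F"
        "card C' = matroid_rank I (insert e F)"
      using extend[OF C(1), of "insert e F"] C by blast
    have "e \<in> C'"
    proof (rule ccontr)
      assume "e \<notin> C'"
      then have "C' \<subseteq> F" using C' by blast
      then show False using card_le_rank[OF C'(1), of F] C'(4) lt by simp
    qed
    then have "insert e B \<in> I" using C C' indep_mono by (meson insert_subset order_trans)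
    then have "card (insert e B) \<le> matroid_rank I A" using card_le_rank e B by blast
    then show False using B e fin_indep by simp
  qed
  then show "A \<in> I" using B by simp
qed

end

lemma matroid_eqI:
  assumes "matroid E I" "matroid E J" "matroid_flats E I = matroid_flats E J"
  shows "I = J"
proof -
  have "A \<in> I \<longleftrightarrow> A \<in> J" if "A \<subseteq> E" for A
    unfolding matroid.indep_iff_flats[OF assms(1) that] matroid.indep_iff_flats[OF assms(2) that]
      assms(3) ..
  then show ?thesis
    using matroid.indep_subset[OF assms(1)] matroid.indep_subset[OF assms(2)] by blast
qed

context oriented_matroid
begin

definition cl :: "'a set \<Rightarrow> 'a set" where
  "cl S = {f \<in> E. \<forall>X\<in>L. S \<subseteq> zero_set E X \<longrightarrow> X f = 0}"

lemma cl_mono: "S \<subseteq> T \<Longrightarrow> cl S \<subseteq> cl T"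
  by (auto simp: cl_def)

lemma cl_sup: "S \<subseteq> E \<Longrightarrow> S \<subseteq> cl S"
  by (auto simp: cl_def zero_set_def)

lemma cl_sub: "cl S \<subseteq> E"
  by (auto simp: cl_def)

lemma cl_least: "S \<subseteq> cl T \<Longrightarrow> cl S \<subseteq> cl T"
  unfolding cl_def zero_set_def by blast

lemma cl_zero_set: "X \<in> L \<Longrightarrow> cl (zero_set E X) = zero_set E X"
  by (auto simp: cl_def zero_set_def)

lemma ex_cl:
  assumes "S \<subseteq> E"
  shows "\<exists>X\<in>L. cl S = zero_set E X"
proof -
  have "\<exists>X\<in>L. S \<subseteq> zero_set E X \<and> (\<forall>f\<in>T. X f \<noteq> 0)" if "finite T" "T \<subseteq> E - cl S" for T
    using that
  proof (induction T)
    case empty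
    then show ?case using zero_covector assms by (auto simp: zero_set_def intro!: bexI[of _ "\<lambda>_. 0"])
  next
    case (insert f T)
    then obtain X where X: "X \<in> L" "S \<subseteq> zero_set E X" "\<forall>f\<in>T. X f \<noteq> 0" by auto
    obtain Y where Y: "Y \<in> L" "S \<subseteq> zero_set E Y" "Y f \<noteq> 0"
      using insert.prems by (auto simp: cl_def)
    show ?case
      by (rule bexI[OF _ comp_covector[OF X(1) Y(1)]])
        (use X Y in \<open>auto simp: sign_comp_def zero_set_def\<close>)
  qed
  from this[of "E - cl S"] finite_ground obtain X
    where X: "X \<in> L" "S \<subseteq> zero_set E X" "\<forall>f\<in>E - cl S. X f \<noteq> 0" by auto
  then have "cl S = zero_set E X" by (auto simp: cl_def zero_set_def)
  then show ?thesis using X by blast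
qed

lemma sign_cases: "X \<in> L \<Longrightarrow> X e = -1 \<or> X e = 0 \<or> X e = 1"
  using covectors_subset unfolding sign_vectors_def by blast

lemma cl_exchange:
  assumes "S \<subseteq> E" "e \<in> E" "f \<in> cl (insert e S)" "f \<notin> cl S"
  shows "e \<in> cl (insert f S)"
proof (rule ccontr)
  assume "e \<notin> cl (insert f S)"
  then obtain Y where Y: "Y \<in> L" "insert f S \<subseteq> zero_set E Y" "Y e \<noteq> 0"
    using assms by (auto simp: cl_def)
  obtain X where X: "X \<in> L" "cl S = zero_set E X" using ex_cl assms by blast
  have fE: "f \<in> E" using assms cl_sub by blast
  have Xf: "X f \<noteq> 0" using X assms fE by (auto simp: zero_set_def)
  have SX: "S \<subseteq> zero_set E X" using X cl_sup assms by blast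
  have Xe: "X e \<noteq> 0"
  proof
    assume "X e = 0"
    then have "insert e S \<subseteq> zero_set E X" using SX assms by (auto simp: zero_set_def)
    then have "X f = 0" using assms(3) X by (auto simp: cl_def)
    then show False using Xf by simp
  qed
  obtain Y' where Y': "Y' \<in> L" "insert f S \<subseteq> zero_set E Y'" "Y' e = - X e"
  proof (cases "Y e = - X e")
    case True then show ?thesis using Y that by blast
  next
    case False
    then have "Y e = X e" using sign_cases[OF X(1), of e] sign_cases[OF Y(1), of e] Xe Y by auto
    then show ?thesis using that[OF uminus_covector[OF Y(1)]] Y by (auto simp: zero_set_def)
  qed
  have "e \<in> separation X Y'" using Y' Xe by (simp add: separation_def)
  then obtain Z where Z: "Z \<in> L" "Z e = 0" "\<forall>g\<in>E - separation X Y'. Z g = sign_comp X Y' g"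
    using elimination X Y' by blast
  have "Z f \<noteq> 0" using Z(3) Xf Y'(2) fE by (auto simp: separation_def sign_comp_def zero_set_def)
  moreover have "insert e S \<subseteq> zero_set E Z"
    using Z SX Y'(2) assms by (auto simp: separation_def sign_comp_def zero_set_def subset_iff)
  ultimately show False using assms(3) Z by (auto simp: cl_def)
qed

definition indep :: "'a set set" where
  "indep = {A. A \<subseteq> E \<and> (\<forall>e\<in>A. e \<notin> cl (A - {e}))}"

lemma insert_indep:
  assumes A: "A \<in> indep" and e: "e \<in> E" "e \<notin> cl A"
  shows "insert e A \<in> indep"
proof -
  have AE: "A \<subseteq> E" using A by (simp add: indep_def)
  have eA: "e \<notin> A" using e cl_sup[OF AE] by blast
  have "f \<notin> cl (insert e A - {f})" if f: "f \<in> A" for f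
  proof
    assume *: "f \<in> cl (insert e A - {f})"
    have "insert e A - {f} = insert e (A - {f})" using f eA by auto
    then have "f \<in> cl (insert e (A - {f}))" using * by simp
    moreover have "f \<notin> cl (A - {f})" using A f by (simp add: indep_def)
    ultimately have "e \<in> cl (insert f (A - {f}))" using cl_exchange AE e by blast
    then show False using e f by (simp add: insert_absorb)
  qed
  moreover have "e \<notin> cl (insert e A - {e})" using eA e by simp
  ultimately show ?thesis using AE e by (auto simp: indep_def)
qed

lemma indep_down: "B \<in> indep \<Longrightarrow> A \<subseteq> B \<Longrightarrow> A \<in> indep"
  unfolding indep_def using cl_mono[of "A - {e}" "B - {e}" for e] by blast

lemma indep_card_le:
  assumes "A \<in> indep" "B \<in> indep" "B \<subseteq> cl A"
  shows "card B \<le> card A"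
  using assms
proof (induction "card (B - A)" arbitrary: B rule: less_induct)
  case less
  have fin: "finite A" "finite B" using less.prems finite_ground finite_subset
    by (auto simp: indep_def)
  show ?case
  proof (cases "B \<subseteq> A")
    case True then show ?thesis using fin card_mono by blast
  next
    case False
    then obtain b where b: "b \<in> B" "b \<notin> A" by blast
    let ?B = "B - {b}"
    have "b \<notin> cl ?B" using less.prems b by (auto simp: indep_def)
    then have "\<not> A \<subseteq> cl ?B" using cl_least less.prems b by blast
    then obtain a where a: "a \<in> A" "a \<notin> cl ?B" by blast
    have aE: "a \<in> E" using a less.prems by (auto simp: indep_def)
    have BE: "?B \<subseteq> E" using less.prems by (auto simp: indep_def)
    have aB: "a \<notin> ?B" using a cl_sup[OF BE] by blast
    have i: "insert a ?B \<in> indep" using insert_indep indep_down less.prems a aE by blast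
    have s: "insert a ?B \<subseteq> cl A" using a cl_sup less.prems by (auto simp: indep_def)
    have "insert a ?B - A = (B - A) - {b}" using a by blast
    then have "card (insert a ?B - A) < card (B - A)" using b fin
      by (metis DiffI card_Diff1_less finite_Diff)
    from less.hyps[OF this less.prems(1) i s] show ?thesis using aB b fin
      by (simp add: card.insert_remove card_Suc_Diff1)
  qed
qed

lemma matroid_indep: "matroid E indep"
proof
  show "finite E" by (rule finite_ground)
  show "A \<subseteq> E" if "A \<in> indep" for A using that by (simp add: indep_def)
  show "{} \<in> indep" by (simp add: indep_def)
  show "A \<in> indep" if "B \<in> indep" "A \<subseteq> B" for A B using that indep_down by blast
  show "\<exists>e\<in>B - A. insert e A \<in> indep"
    if AB: "A \<in> indep" "B \<in> indep" "card A < card B" for A B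
  proof -
    have "\<not> B \<subseteq> cl A" using indep_card_le AB by force
    then obtain e where "e \<in> B" "e \<notin> cl A" by blast
    moreover have "A \<subseteq> cl A" "B \<subseteq> E" using AB cl_sup by (auto simp: indep_def)
    ultimately show ?thesis using insert_indep AB by blast
  qed
qed

lemma flats_indep: "matroid_flats E indep = zero_set E ` L"
proof -
  interpret matroid E indep by (rule matroid_indep)
  have flat_iff: "F \<in> matroid_flats E indep \<longleftrightarrow> F \<subseteq> E \<and> cl F = F" for F
  proof
    assume F: "F \<in> matroid_flats E indep"
    then have FE: "F \<subseteq> E" by (simp add: matroid_flats_def)
    obtain A where A: "A \<in> indep" "A \<subseteq> F" "card A = matroid_rank indep F" using ex_rank by blast
    have "F \<subseteq> cl A"
    proof (rule ccontr)
      assume "\<not> F \<subseteq> cl A"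
      then obtain e where e: "e \<in> F" "e \<notin> cl A" by blast
      then have "insert e A \<in> indep" using insert_indep A FE by blast
      then have "card (insert e A) \<le> card A" using card_le_rank A e by (metis insert_subset)
      moreover have "e \<notin> A" using e cl_sup A FE by (meson order_trans subset_iff)
      ultimately show False using fin_indep A by simp
    qed
    have "e \<in> F" if e: "e \<in> cl F" for e
    proof (rule ccontr)
      assume "e \<notin> F"
      then have lt: "matroid_rank indep F < matroid_rank indep (insert e F)"
        using F e cl_sub by (auto simp: matroid_flats_def)
      obtain B where B: "B \<in> indep" "B \<subseteq> insert e F" "card B = matroid_rank indep (insert e F)"
        using ex_rank by blast
      have "B \<subseteq> cl A" using B e \<open>F \<subseteq> cl A\<close> cl_least by blast
      then have "card B \<le> card A" using indep_card_le A B by blast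
      then show False using lt A B by simp
    qed
    then show "F \<subseteq> E \<and> cl F = F" using FE cl_sup by blast
  next
    assume F: "F \<subseteq> E \<and> cl F = F"
    obtain A where A: "A \<in> indep" "A \<subseteq> F" "card A = matroid_rank indep F" using ex_rank by blast
    have "matroid_rank indep F < matroid_rank indep (insert e F)" if e: "e \<in> E - F" for e
    proof -
      have "e \<notin> cl A" using e F A cl_mono by blast
      then have "insert e A \<in> indep" using insert_indep A e by blast
      then have "card (insert e A) \<le> matroid_rank indep (insert e F)"
        using card_le_rank A by blast
      moreover have "e \<notin> A" using e A by blast
      ultimately show ?thesis using A fin_indep by simp
    qed
    then show "F \<in> matroid_flats E indep" using F by (auto simp: matroid_flats_def)
  qed
  have to_zero: "F \<in> zero_set E ` L" if "F \<subseteq> E" "cl F = F" for F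
    using ex_cl[OF that(1)] that(2) by auto
  have of_zero: "F \<subseteq> E \<and> cl F = F" if "F \<in> zero_set E ` L" for F
    using that cl_zero_set cl_sub by auto
  show ?thesis
    by (intro set_eqI iffI) (simp_all only: flat_iff to_zero of_zero)
qed

end

theorem underlying_matroid_unique:
  assumes "oriented_matroid E L"
  shows "\<exists>!I. matroid E I \<and> matroid_flats E I = zero_set E ` L"
proof (rule ex1I)
  interpret oriented_matroid E L by fact
  show "matroid E indep \<and> matroid_flats E indep = zero_set E ` L"
    using matroid_indep flats_indep by blast
  then show "I = indep" if "matroid E I \<and> matroid_flats E I = zero_set E ` L" for I
    using matroid_eqI that by metis
qed

corollary underlying_matroid:
  assumes "oriented_matroid E L"
  shows "matroid E (underlying_matroid E L)"
    and "matroid_flats E (underlying_matroid E L) = zero_set E ` L"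
  using theI'[OF underlying_matroid_unique[OF assms]] unfolding underlying_matroid_def by auto

end

theory Submission
  imports Defs
begin

text \<open>Write \<open>r\<close> for the rank function. The rank of \<open>S\<close> in the initial matroid of \<open>w\<close> is
  \<open>wt (w + 1\<^sub>S) - wt w\<close>, so the zeta function at \<open>-1\<close> is the sum of
  \<open>(-1) ^ (|S| + wt (w + 1\<^sub>S)) q ^ |w|\<close> over all \<open>w\<close> and \<open>S\<close>. Splitting off the support \<open>H\<close>
  of \<open>w\<close> gives a recursion that expresses its analogue \<open>\<zeta> F\<close>, for \<open>F \<subseteq> E\<close>, through the \<open>\<zeta> H\<close>
  with \<open>H \<subseteq> F\<close>.

  On the oriented side, signed sums \<open>\<Sum>X. (-1) ^ r (Z X) \<phi> X\<close> over covectors are invariant under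
  deletion of elements when \<open>\<phi>\<close> ignores the deleted coordinates. Hence
  \<open>\<Sum>X. (-1) ^ r (Z X) q ^ (|Z X| + |S (A, X)|) = 1\<close> for every tope \<open>A\<close>, and a weighting \<open>v\<close> of the
  distance matrix is given recursively by
  \<open>v B = (\<Sum>X \<le> B. (-1) ^ r (Z X) q ^ |Z X| v\<^bsub>Z X\<^esub> (B|Z X))\<close>, the sum including
  \<open>X = 0\<close>, where \<open>v\<^bsub>H\<^esub>\<close> is the weighting for the restriction to \<open>H\<close>. Its total satisfies
  the recursion of \<open>\<zeta>\<close>.\<close>

section \<open>Matroid weights and initial matroids\<close>

context matroid
begin

text \<open>Phrased by ranks of superlevel sets rather than by maximal weight, so that greediness
  passes between weights whose layers are related. The layer \<open>k = 0\<close> is all of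
  \<open>E\<close>, where being a basis already gives full rank.\<close>

definition greedy_basis :: "('a \<Rightarrow> nat) \<Rightarrow> 'a set \<Rightarrow> bool" where
  "greedy_basis w B \<longleftrightarrow> B \<in> matroid_bases I \<and>
    (\<forall>k>0. card (B \<inter> {e. k \<le> w e}) = matroid_rank I {e \<in> E. k \<le> w e})"

lemma card_rank_imp_basis:
  assumes "B \<in> I" "card B = matroid_rank I E"
  shows "B \<in> matroid_bases I"
proof -
  have "A = B" if A: "A \<in> I" "B \<subseteq> A" for A
  proof -
    have "card A \<le> card B" using card_le_rank[OF A(1) indep_subset[OF A(1)]] assms by simp
    then show ?thesis using A fin_indep card_seteq by blast
  qed
  then show ?thesis using assms(1) by (auto simp: matroid_bases_def)
qed

text \<open>The greedy algorithm over decreasing thresholds: an independent set of full rank in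
  every higher layer is extended to full rank in the next one.\<close>

lemma ex_greedy_basis: "\<exists>B. greedy_basis w B"
proof -
  obtain N where N: "\<forall>e\<in>E. w e < N"
    using finite_nat_set_iff_bounded[of "w ` E"] finite_ground by auto
  \<comment> \<open>The threshold \<open>N - m\<close> starts above all weights, where the layers
    are empty, and reaches \<open>0\<close> at \<open>m = N\<close>, where the layer is
    \<open>E\<close>.\<close>
  have "\<exists>A\<in>I. A \<subseteq> {e \<in> E. N - m \<le> w e} \<and>
      (\<forall>k\<ge>N - m. card (A \<inter> {e. k \<le> w e}) = matroid_rank I {e \<in> E. k \<le> w e})" for m
  proof (induction m)
    case 0
    have *: "{e \<in> E. k \<le> w e} = {}" if "k \<ge> N" for k using N that by fastforce
    have "\<forall>k\<ge>N. card ({} \<inter> {e. k \<le> w e}) = matroid_rank I {e \<in> E. k \<le> w e}"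
      using rank_indep[OF indep_empty] by (simp add: *)
    then show ?case using indep_empty by auto
  next
    case (Suc m)
    let ?S = "{e \<in> E. N - Suc m \<le> w e}"
    obtain A where A: "A \<in> I" "A \<subseteq> {e \<in> E. N - m \<le> w e}"
      "\<And>k. k \<ge> N - m \<Longrightarrow> card (A \<inter> {e. k \<le> w e}) = matroid_rank I {e \<in> E. k \<le> w e}"
      using Suc by blast
    have "A \<subseteq> ?S" using A(2) by auto
    then obtain C where C: "C \<in> I" "A \<subseteq> C" "C \<subseteq> ?S" "card C = matroid_rank I ?S"
      using extend[OF A(1)] by blast
    have "card (C \<inter> {e. k \<le> w e}) = matroid_rank I {e \<in> E. k \<le> w e}" if k: "k \<ge> N - Suc m" for k
    proof (cases "k = N - Suc m")
      case True
      then have "C \<inter> {e. k \<le> w e} = C" using C(3) by auto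
      then show ?thesis using C True by simp
    next
      case False
      \<comment> \<open>\<open>A\<close> already fills the higher layers, so the elements added in
        passing to \<open>C\<close> cannot enlarge the trace there.\<close>
      have "card (A \<inter> {e. k \<le> w e}) \<le> card (C \<inter> {e. k \<le> w e})"
        using C(2) fin_indep[OF C(1)] by (intro card_mono) auto
      moreover have "card (C \<inter> {e. k \<le> w e}) \<le> matroid_rank I {e \<in> E. k \<le> w e}"
        using indep_subset[OF C(1)] by (intro card_le_rank) (auto intro: indep_mono[OF C(1)])
      ultimately show ?thesis using A(3)[of k] k False by simp
    qed
    then show ?case using C by blast
  qed
  from this[of N] obtain B where B: "B \<in> I"
    "\<And>k. card (B \<inter> {e. k \<le> w e}) = matroid_rank I {e \<in> E. k \<le> w e}" by auto
  have "B \<in> matroid_bases I" using card_rank_imp_basis[OF B(1)] B(2)[of 0] by simp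
  then show ?thesis using B(2) unfolding greedy_basis_def by blast
qed

lemma sum_layers:
  assumes "finite B" "\<forall>e\<in>B. w e \<le> N"
  shows "(\<Sum>e\<in>B. w e) = (\<Sum>k=1..N. card (B \<inter> {e. k \<le> w e}))"
proof -
  have "w e = (\<Sum>k=1..N. if k \<le> w e then 1 else 0)" if "e \<in> B" for e
  proof -
    have "(\<Sum>k=1..N. if k \<le> w e then 1 else 0) = card ({1..N} \<inter> {k. k \<le> w e})"
      by (simp add: sum.If_cases)
    also have "{1..N} \<inter> {k. k \<le> w e} = {1..w e}" using assms(2) that by fastforce
    finally show ?thesis by simp
  qed
  then have "(\<Sum>e\<in>B. w e) = (\<Sum>e\<in>B. \<Sum>k=1..N. if k \<le> w e then 1 else 0)" by (rule sum.cong[OF refl])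
  also have "\<dots> = (\<Sum>k=1..N. \<Sum>e\<in>B. if k \<le> w e then 1 else 0)" by (rule sum.swap)
  finally show ?thesis using assms(1) by (simp add: sum.If_cases)
qed

lemma finite_bases: "finite (matroid_bases I)"
  using finite_I by (auto simp: matroid_bases_def intro: finite_subset)

text \<open>By \<open>sum_layers\<close> the weight of a basis is the sum of its layer sizes. Each
  layer of a basis is independent, hence bounded by the rank of the superlevel set, and a greedy
  basis attains all these bounds at once.\<close>

lemma wt_greedy:
  assumes "greedy_basis w B"
  shows "matroid_wt I w = (\<Sum>e\<in>B. w e)"
  unfolding matroid_wt_def
proof (rule Max_eqI)
  show "finite ((\<lambda>B. \<Sum>e\<in>B. w e) ` matroid_bases I)" using finite_bases by simp
  show "(\<Sum>e\<in>B. w e) \<in> (\<lambda>B. \<Sum>e\<in>B. w e) ` matroid_bases I"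
    using assms by (auto simp: greedy_basis_def)
  fix y assume "y \<in> (\<lambda>B. \<Sum>e\<in>B. w e) ` matroid_bases I"
  then obtain A where A: "A \<in> matroid_bases I" "y = (\<Sum>e\<in>A. w e)" by blast
  have I: "A \<in> I" "B \<in> I" using A assms by (auto simp: greedy_basis_def matroid_bases_def)
  obtain N where N: "\<forall>e\<in>E. w e \<le> N"
    using finite_nat_set_iff_bounded_le[of "w ` E"] finite_ground by auto
  have "y = (\<Sum>k=1..N. card (A \<inter> {e. k \<le> w e}))"
    using sum_layers[of A w N] I fin_indep indep_subset N A(2) by blast
  also have "\<dots> \<le> (\<Sum>k=1..N. matroid_rank I {e \<in> E. k \<le> w e})"
    using indep_subset[OF I(1)] by (intro sum_mono card_le_rank) (auto intro: indep_mono[OF I(1)])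
  also have "\<dots> = (\<Sum>k=1..N. card (B \<inter> {e. k \<le> w e}))"
    using assms by (intro sum.cong) (auto simp: greedy_basis_def)
  also have "\<dots> = (\<Sum>e\<in>B. w e)"
    using sum_layers[of B w N] I fin_indep indep_subset N by (metis subsetD)
  finally show "y \<le> (\<Sum>e\<in>B. w e)" .
qed

lemma wt_ge: "B \<in> matroid_bases I \<Longrightarrow> (\<Sum>e\<in>B. w e) \<le> matroid_wt I w"
  unfolding matroid_wt_def using finite_bases by (intro Max_ge) auto

lemma wt_mono:
  assumes "\<And>e. w e \<le> w' e"
  shows "matroid_wt I w \<le> matroid_wt I w'"
proof -
  obtain B where B: "greedy_basis w B" using ex_greedy_basis by blast
  then have "matroid_wt I w = (\<Sum>e\<in>B. w e)" by (rule wt_greedy)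
  also have "\<dots> \<le> (\<Sum>e\<in>B. w' e)" by (rule sum_mono[OF assms])
  also have "\<dots> \<le> matroid_wt I w'" using B wt_ge by (auto simp: greedy_basis_def)
  finally show ?thesis .
qed

lemma wt_zero: "matroid_wt I (\<lambda>_. 0) = 0"
proof -
  obtain B where "greedy_basis (\<lambda>_. 0) B" using ex_greedy_basis by blast
  from wt_greedy[OF this] show ?thesis by simp
qed

lemma sum_indicator: "finite B \<Longrightarrow> (\<Sum>e\<in>B. of_bool (e \<in> S)) = card (B \<inter> S)"
  by (simp add: of_bool_def sum.If_cases)

text \<open>Since \<open>u\<close> vanishes off \<open>S\<close>, the layers of the sum are
  \<open>S\<close> followed by the layers of \<open>u\<close>, with the index shifted by one. A
  basis greedy for the sum is therefore greedy for \<open>u\<close> and meets \<open>S\<close> in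
  full rank.\<close>

lemma wt_indicator_add:
  assumes "S \<subseteq> E" "\<And>e. e \<notin> S \<Longrightarrow> u e = 0"
  shows "matroid_wt I (\<lambda>e. of_bool (e \<in> S) + u e) = matroid_rank I S + matroid_wt I u"
proof -
  let ?w = "\<lambda>e. of_bool (e \<in> S) + u e"
  obtain B where B: "greedy_basis ?w B" using ex_greedy_basis by blast
  then have Bb: "B \<in> matroid_bases I" and fin: "finite B"
    by (auto simp: greedy_basis_def matroid_bases_def fin_indep)
  have iff: "Suc k \<le> ?w e \<longleftrightarrow> (if k = 0 then e \<in> S else k \<le> u e)" for k e
    using assms(2)[of e] by (cases "e \<in> S") auto
  have *: "{e. Suc k \<le> ?w e} = (if k = 0 then S else {e. k \<le> u e})" for k
    unfolding iff by simp
  have **: "{e \<in> E. Suc k \<le> ?w e} = (if k = 0 then S else {e \<in> E. k \<le> u e})" for k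
    unfolding iff using assms(1) by auto
  have g: "card (B \<inter> {e. Suc k \<le> ?w e}) = matroid_rank I {e \<in> E. Suc k \<le> ?w e}" for k
    using B unfolding greedy_basis_def by blast
  have S: "card (B \<inter> S) = matroid_rank I S" using g[of 0] unfolding * ** by simp
  have "greedy_basis u B"
    unfolding greedy_basis_def
  proof (intro conjI allI impI Bb)
    fix k :: nat assume "k > 0"
    then show "card (B \<inter> {e. k \<le> u e}) = matroid_rank I {e \<in> E. k \<le> u e}"
      using g[of k] unfolding * ** by simp
  qed
  then have "matroid_wt I u = (\<Sum>e\<in>B. u e)" by (rule wt_greedy)
  moreover have "matroid_wt I ?w = (\<Sum>e\<in>B. ?w e)" using B by (rule wt_greedy)
  ultimately show ?thesis using S sum_indicator[OF fin] by (simp add: sum.distrib)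
qed

text \<open>The layers of \<open>2w + 1\<^sub>S\<close> refine those of both \<open>w\<close> and \<open>w + 1\<^sub>S\<close>, so one basis
  is greedy for all three weights.\<close>

lemma rank_initial_matroid:
  assumes "S \<subseteq> E"
  shows "matroid_rank (initial_matroid I w) S + matroid_wt I w =
    matroid_wt I (\<lambda>e. of_bool (e \<in> S) + w e)"
proof -
  let ?w = "\<lambda>e. of_bool (e \<in> S) + w e" and ?u = "\<lambda>e. of_bool (e \<in> S) + 2 * w e"
  obtain B where B: "greedy_basis ?u B" using ex_greedy_basis by blast
  then have Bb: "B \<in> matroid_bases I" and fin: "finite B"
    by (auto simp: greedy_basis_def matroid_bases_def fin_indep)
  have g: "card (B \<inter> {e. k \<le> ?u e}) = matroid_rank I {e \<in> E. k \<le> ?u e}" if "k > 0" for k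
    using B that unfolding greedy_basis_def by blast
  have "card (B \<inter> {e. k \<le> w e}) = matroid_rank I {e \<in> E. k \<le> w e}" if "k > 0" for k
  proof -
    \<comment> \<open>By parity, even thresholds of \<open>2w + 1\<^sub>S\<close> see only
      \<open>w\<close>, and odd ones see \<open>w + 1\<^sub>S\<close>.\<close>
    have *: "k \<le> w e \<longleftrightarrow> 2 * k \<le> ?u e" for e by (cases "e \<in> S") auto
    show ?thesis unfolding * using that by (intro g) simp
  qed
  then have "greedy_basis w B" unfolding greedy_basis_def using Bb by blast
  then have w: "matroid_wt I w = (\<Sum>e\<in>B. w e)" by (rule wt_greedy)
  have "card (B \<inter> {e. k \<le> ?w e}) = matroid_rank I {e \<in> E. k \<le> ?w e}" if "k > 0" for k
  proof -
    have *: "k \<le> ?w e \<longleftrightarrow> 2 * k - 1 \<le> ?u e" for e by (cases "e \<in> S") auto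
    show ?thesis unfolding * using that by (intro g) simp
  qed
  then have "greedy_basis ?w B" unfolding greedy_basis_def using Bb by blast
  then have w': "matroid_wt I ?w = card (B \<inter> S) + matroid_wt I w"
    using wt_greedy sum_indicator[OF fin] w by (simp add: sum.distrib)
  have "matroid_rank (initial_matroid I w) S = card (B \<inter> S)"
    unfolding matroid_rank_def
  proof (rule Max_eqI)
    have "{card A |A. A \<in> initial_matroid I w \<and> A \<subseteq> S} \<subseteq> card ` Pow S" by auto
    then show "finite {card A |A. A \<in> initial_matroid I w \<and> A \<subseteq> S}"
      using finite_subset finite_subset[OF assms finite_ground] by blast
    show "card (B \<inter> S) \<in> {card A |A. A \<in> initial_matroid I w \<and> A \<subseteq> S}"
      using Bb w by (auto simp: initial_matroid_def)
    fix y assume "y \<in> {card A |A. A \<in> initial_matroid I w \<and> A \<subseteq> S}"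
    then obtain A C where A: "y = card A" "A \<subseteq> S" "A \<subseteq> C" "C \<in> matroid_bases I"
      "(\<Sum>e\<in>C. w e) = matroid_wt I w" by (auto simp: initial_matroid_def)
    then have finC: "finite C" by (auto simp: matroid_bases_def fin_indep)
    have "y \<le> card (C \<inter> S)" using A finC by (auto intro: card_mono)
    \<comment> \<open>A basis \<open>C\<close> of maximal \<open>w\<close>-weight has
      \<open>?w\<close>-weight \<open>card (C \<inter> S) + matroid_wt I w\<close>. This is at most
      the value attained by \<open>B\<close>, so \<open>B\<close> also has the largest trace on
      \<open>S\<close>.\<close>
    moreover have "card (C \<inter> S) + matroid_wt I w \<le> matroid_wt I ?w"
      using wt_ge[OF A(4), of ?w] A(5) sum_indicator[OF finC] by (simp add: sum.distrib)
    ultimately show "y \<le> card (B \<inter> S)" using w' by simp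
  qed
  then show ?thesis using w' by simp
qed

end

section \<open>Restrictions of covectors\<close>

text \<open>Extension by zero keeps restrictions to different sets in one type, where they can be
  composed and restricted again.\<close>

definition restr :: "'a set \<Rightarrow> ('a \<Rightarrow> int) \<Rightarrow> 'a \<Rightarrow> int" where
  "restr G X = (\<lambda>e. if e \<in> G then X e else 0)"

lemma restr_restr: "G \<subseteq> H \<Longrightarrow> restr G (restr H X) = restr G X"
  by (auto simp: restr_def fun_eq_iff)

lemma sum_of_bool_eq:
  "finite A \<Longrightarrow> a \<in> A \<Longrightarrow> (\<Sum>x\<in>A. f x * of_bool (x = a)) = (f a :: 'b::semiring_1)"
  by (subst sum.remove[of A a]) auto

lemma prod_of_bool:
  "finite A \<Longrightarrow> (\<Prod>x\<in>A. of_bool (P x)) = (of_bool (\<forall>x\<in>A. P x) :: 'b::comm_semiring_1)"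
  by (induction A rule: finite_induct) auto

context oriented_matroid
begin

abbreviation rk :: "'a set \<Rightarrow> nat" where "rk \<equiv> matroid_rank indep"

text \<open>One rank function serves all restrictions, as the rank of a subset of \<open>G\<close>
  does not change when elements outside \<open>G\<close> are deleted. The sign is a power series so
  that it multiplies powers of \<open>q\<close> directly.\<close>

definition rank_sign :: "'a set \<Rightarrow> rat fps" where "rank_sign S = (-1) ^ rk S"

text \<open>The covectors of the oriented matroid obtained by deleting \<open>E - G\<close>.\<close>

definition restrictions :: "'a set \<Rightarrow> ('a \<Rightarrow> int) set" where "restrictions G = restr G ` L"

text \<open>A maximal independent subset of \<open>Z\<close> spans \<open>Z\<close>, so it can be
  enlarged by \<open>e\<close> exactly when \<open>e\<close> is outside the closure. This ties the
  rank to the closure, which is defined by covectors.\<close>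

lemma rank_insert:
  assumes "Z \<subseteq> E" "e \<in> E"
  shows "rk (insert e Z) = (if e \<in> cl Z then rk Z else Suc (rk Z))"
proof -
  interpret M: matroid E indep by (rule matroid_indep)
  obtain A where A: "A \<in> indep" "A \<subseteq> Z" "card A = rk Z" using M.ex_rank by blast
  obtain B where B: "B \<in> indep" "B \<subseteq> insert e Z" "card B = rk (insert e Z)" using M.ex_rank by blast
  have AE: "A \<subseteq> E" using A assms by blast
  have ZA: "Z \<subseteq> cl A"
  proof
    fix f assume f: "f \<in> Z"
    show "f \<in> cl A"
    proof (rule ccontr)
      assume nf: "f \<notin> cl A"
      then have "insert f A \<in> indep" using insert_indep A f assms by blast
      then have "card (insert f A) \<le> card A" using M.card_le_rank A f by (metis insert_subset)
      moreover have "f \<notin> A" using nf cl_sup AE by blast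
      ultimately show False using M.fin_indep A by simp
    qed
  qed
  show ?thesis
  proof (cases "e \<in> cl Z")
    case True
    then have "B \<subseteq> cl A" using B ZA cl_least by blast
    then have "card B \<le> card A" using indep_card_le A B by blast
    moreover have "rk Z \<le> rk (insert e Z)" by (rule M.rank_mono) blast
    ultimately show ?thesis using True A B by simp
  next
    case False
    have eA: "e \<notin> cl A" using False A(2) cl_mono by blast
    then have "insert e A \<in> indep" using insert_indep A assms by blast
    then have "card (insert e A) \<le> rk (insert e Z)" using M.card_le_rank A by blast
    moreover have "e \<notin> A" using eA cl_sup AE by blast
    ultimately have "Suc (rk Z) \<le> rk (insert e Z)" using A M.fin_indep by simp
    moreover have "card (B - {e}) \<le> rk Z"
      using B indep_down by (intro M.card_le_rank) auto
    then have "rk (insert e Z) \<le> Suc (rk Z)"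
      using B(3) M.fin_indep[OF B(1)] by (cases "e \<in> B") (auto simp: card_Diff_singleton_if)
    ultimately show ?thesis using False by simp
  qed
qed

lemma finite_covectors: "finite L"
proof -
  have "L \<subseteq> {f. \<forall>x. (x \<in> E \<longrightarrow> f x \<in> {-1, 0, 1}) \<and> (x \<notin> E \<longrightarrow> f x = 0)}"
    using covectors_subset by (auto simp: sign_vectors_def)
  moreover have "finite \<dots>" by (rule finite_set_of_finite_funs[OF finite_ground]) simp
  ultimately show ?thesis using finite_subset by blast
qed

lemma finite_restrictions: "finite (restrictions G)"
  using finite_covectors by (simp add: restrictions_def)

lemma restrictions_sign: "X \<in> restrictions G \<Longrightarrow> X e = -1 \<or> X e = 0 \<or> X e = 1"
  using sign_cases unfolding restrictions_def restr_def by fastforce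

lemma restrictions_outside: "X \<in> restrictions G \<Longrightarrow> e \<notin> G \<Longrightarrow> X e = 0"
  by (auto simp: restrictions_def restr_def)

lemma restr_in_restrictions: "X \<in> restrictions H \<Longrightarrow> G \<subseteq> H \<Longrightarrow> restr G X \<in> restrictions G"
  by (auto simp: restrictions_def restr_restr)

lemma restr_restrictions_id: "X \<in> restrictions G \<Longrightarrow> restr G X = X"
  by (auto simp: restrictions_def restr_restr)

lemma zero_in_restrictions: "(\<lambda>_. 0) \<in> restrictions G"
  unfolding restrictions_def by (rule image_eqI[OF _ zero_covector]) (simp add: restr_def)

lemma restrictions_ground: "restrictions E = L"
proof -
  have "restr E X = X" if "X \<in> L" for X
    using that covectors_subset by (auto simp: restr_def fun_eq_iff sign_vectors_def)
  then show ?thesis by (auto simp: restrictions_def)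
qed

text \<open>The fibre of a restriction that deletes one element consists either of a single sign, or of
  all three signs, where the zero sign raises the rank of the zero set and cancels one of the
  other two.\<close>

lemma sum_fibre:
  assumes G: "G \<subseteq> E" and e: "e \<in> E" "e \<notin> G" and X: "X \<in> restrictions G"
  shows "(\<Sum>Y\<in>{Y \<in> restrictions (insert e G). restr G Y = X}. rank_sign (zero_set (insert e G) Y)) =
    rank_sign (zero_set G X)"
proof -
  \<comment> \<open>The signs at \<open>e\<close> that occur in the fibre over \<open>X\<close>;
    such a sign determines the member of the fibre.\<close>
  define V where "V = {Y e | Y. Y \<in> L \<and> restr G Y = X}"
  define z where "z = zero_set G X"
  have zE: "z \<subseteq> E" using G by (auto simp: z_def zero_set_def)
  have "{Y \<in> restrictions (insert e G). restr G Y = X} = (\<lambda>s. X(e := s)) ` V"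
  proof (intro set_eqI iffI)
    fix Y assume "Y \<in> {Y \<in> restrictions (insert e G). restr G Y = X}"
    then obtain W where W: "W \<in> L" "Y = restr (insert e G) W" "restr G Y = X"
      by (auto simp: restrictions_def)
    then have "restr G W = X" by (simp add: restr_restr subset_insertI)
    moreover from this have "Y = X(e := W e)" using W(2) by (auto simp: restr_def fun_eq_iff)
    ultimately show "Y \<in> (\<lambda>s. X(e := s)) ` V" using W(1) by (auto simp: V_def)
  next
    fix Y assume "Y \<in> (\<lambda>s. X(e := s)) ` V"
    then obtain W where W: "W \<in> L" "restr G W = X" "Y = X(e := W e)" by (auto simp: V_def)
    then have "Y = restr (insert e G) W" by (force simp: restr_def)
    then show "Y \<in> {Y \<in> restrictions (insert e G). restr G Y = X}"
      using W by (auto simp: restrictions_def restr_restr subset_insertI)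
  qed
  moreover have "inj_on (\<lambda>s. X(e := s)) V" by (rule inj_onI) (metis fun_upd_same)
  moreover have "zero_set (insert e G) (X(e := s)) = (if s = 0 then insert e z else z)" for s
    using e by (auto simp: zero_set_def z_def)
  ultimately have sum: "(\<Sum>Y\<in>{Y \<in> restrictions (insert e G). restr G Y = X}. rank_sign (zero_set (insert e G) Y)) =
      (\<Sum>s\<in>V. rank_sign (if s = 0 then insert e z else z))"
    by (simp add: sum.reindex)
  have Vsub: "V \<subseteq> {-1, 0, 1}" using sign_cases by (auto simp: V_def)
  have Vne: "V \<noteq> {}" using X by (auto simp: V_def restrictions_def)
  \<comment> \<open>\<open>Y1\<close> and \<open>Y2\<close> agree on \<open>G\<close>, so the
    separation set misses \<open>G\<close> and the eliminated covector still restricts to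
    \<open>X\<close>.\<close>
  have elim: "0 \<in> V" if "1 \<in> V" "-1 \<in> V"
  proof -
    obtain Y1 Y2 where Y: "Y1 \<in> L" "restr G Y1 = X" "Y1 e = 1" "Y2 \<in> L" "restr G Y2 = X" "Y2 e = -1"
      using \<open>1 \<in> V\<close> \<open>-1 \<in> V\<close> unfolding V_def by fastforce
    have "e \<in> separation Y1 Y2" using Y by (simp add: separation_def)
    then obtain Z where Z: "Z \<in> L" "Z e = 0" "\<forall>f\<in>E - separation Y1 Y2. Z f = sign_comp Y1 Y2 f"
      using elimination Y by blast
    have "Z f = X f" if f: "f \<in> G" for f
    proof -
      have "Y1 f = X f" "Y2 f = X f"
        using f Y(2,5) by (auto simp: restr_def fun_eq_iff split: if_splits)
      then show ?thesis using Z(3) f G by (auto simp: separation_def sign_comp_def)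
    qed
    then have "restr G Z = X" using X by (auto simp: restr_def fun_eq_iff restrictions_outside)
    then show ?thesis using Z by (auto simp: V_def)
  qed
  have "(\<Sum>s\<in>V. rank_sign (if s = 0 then insert e z else z)) = rank_sign z"
  proof (cases "e \<in> cl z")
    case True
    have "V \<subseteq> {0}"
    proof (rule ccontr)
      assume "\<not> V \<subseteq> {0}"
      then obtain Y where Y: "Y \<in> L" "restr G Y = X" "Y e \<noteq> 0" by (auto simp: V_def)
      then have "z \<subseteq> zero_set E Y" using zE by (auto simp: z_def zero_set_def restr_def)
      then show False using True Y by (auto simp: cl_def)
    qed
    then have "V = {0}" using Vne by blast
    moreover have "rk (insert e z) = rk z" using rank_insert[OF zE e(1)] True by simp
    ultimately show ?thesis by (simp add: rank_sign_def)
  next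
    case False
    then have rank_sign: "rank_sign (insert e z) = - rank_sign z" using rank_insert[OF zE e(1)] by (simp add: rank_sign_def)
    show ?thesis
    proof (cases "0 \<in> V")
      case True
      then obtain Y where Y: "Y \<in> L" "restr G Y = X" "Y e = 0" by (auto simp: V_def)
      obtain W where W: "W \<in> L" "z \<subseteq> zero_set E W" "W e \<noteq> 0"
        using False e by (auto simp: cl_def)
      \<comment> \<open>\<open>Y\<close> vanishes at \<open>e\<close> and restricts to
        \<open>X\<close>. Composing it with a covector that vanishes on \<open>z\<close> keeps the
        restriction and imposes the sign of that covector at \<open>e\<close>; applied to
        \<open>W\<close> and its negative, this yields all three signs.\<close>
      have in_V: "W' e \<in> V" if "W' \<in> L" "z \<subseteq> zero_set E W'" for W'
      proof -
        have "restr G (sign_comp Y W') = X"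
        proof
          fix f
          show "restr G (sign_comp Y W') f = X f"
          proof (cases "f \<in> G")
            case True
            then have "Y f = X f" using Y(2) by (auto simp: restr_def)
            then show ?thesis using that True by (auto simp: restr_def sign_comp_def z_def zero_set_def)
          qed (use X in \<open>simp add: restr_def restrictions_outside\<close>)
        qed
        moreover have "sign_comp Y W' \<in> L" by (rule comp_covector[OF Y(1) that(1)])
        moreover have "sign_comp Y W' e = W' e" using Y(3) by (simp add: sign_comp_def)
        ultimately show ?thesis unfolding V_def by (metis (mono_tags, lifting) mem_Collect_eq)
      qed
      have "W e \<in> V" "- W e \<in> V"
        using in_V[OF W(1,2)] in_V[OF uminus_covector[OF W(1)]] W(2) by (auto simp: zero_set_def)
      then have "V = {-1, 0, 1}" using Vsub True W(3) sign_cases[OF W(1), of e] by auto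
      then show ?thesis using rank_sign by simp
    next
      case F: False
      then have "V = {1} \<or> V = {-1}" using Vsub Vne elim by auto
      then show ?thesis by auto
    qed
  qed
  then show ?thesis using sum by (simp add: z_def)
qed

text \<open>The elements of \<open>H - G\<close> are deleted one by one. At each deletion a fibre
  contributes the sign of its image by \<open>sum_fibre\<close>, while the other factor is constant
  on the fibre.\<close>

lemma pushforward:
  fixes \<phi> :: "('a \<Rightarrow> int) \<Rightarrow> rat fps"
  assumes "G \<subseteq> H" "H \<subseteq> E"
  shows "(\<Sum>Y\<in>restrictions H. rank_sign (zero_set H Y) * \<phi> (restr G Y)) = (\<Sum>X\<in>restrictions G. rank_sign (zero_set G X) * \<phi> X)"
proof -
  have step: "(\<Sum>Y\<in>restrictions (insert e K). rank_sign (zero_set (insert e K) Y) * \<psi> (restr K Y)) =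
      (\<Sum>X\<in>restrictions K. rank_sign (zero_set K X) * \<psi> X)"
    if K: "K \<subseteq> E" "e \<in> E" "e \<notin> K" for K e and \<psi> :: "('a \<Rightarrow> int) \<Rightarrow> rat fps"
  proof -
    have "(\<Sum>Y\<in>restrictions (insert e K). rank_sign (zero_set (insert e K) Y) * \<psi> (restr K Y)) =
        (\<Sum>X\<in>restrictions K. \<Sum>Y\<in>{Y \<in> restrictions (insert e K). restr K Y = X}.
          rank_sign (zero_set (insert e K) Y) * \<psi> (restr K Y))"
      by (rule sum.group[symmetric]) (auto simp: finite_restrictions intro: restr_in_restrictions)
    also have "\<dots> = (\<Sum>X\<in>restrictions K. (\<Sum>Y\<in>{Y \<in> restrictions (insert e K). restr K Y = X}.
          rank_sign (zero_set (insert e K) Y)) * \<psi> X)"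
      unfolding sum_distrib_right by (intro sum.cong refl) auto
    also have "\<dots> = (\<Sum>X\<in>restrictions K. rank_sign (zero_set K X) * \<psi> X)"
      using sum_fibre[OF K] by (intro sum.cong refl) simp
    finally show ?thesis .
  qed
  have "(\<Sum>Y\<in>restrictions (G \<union> K). rank_sign (zero_set (G \<union> K) Y) * \<phi> (restr G Y)) =
      (\<Sum>X\<in>restrictions G. rank_sign (zero_set G X) * \<phi> X)" if "finite K" "K \<subseteq> H - G" for K
    using that
  proof (induction K)
    case empty
    then show ?case by (intro sum.cong) (auto simp: restr_restrictions_id)
  next
    case (insert e K)
    have "(\<Sum>Y\<in>restrictions (insert e (G \<union> K)). rank_sign (zero_set (insert e (G \<union> K)) Y) * \<phi> (restr G Y)) =
        (\<Sum>Y\<in>restrictions (insert e (G \<union> K)). rank_sign (zero_set (insert e (G \<union> K)) Y) *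
          \<phi> (restr G (restr (G \<union> K) Y)))"
      by (simp add: restr_restr)
    also have "\<dots> = (\<Sum>Y\<in>restrictions (G \<union> K). rank_sign (zero_set (G \<union> K) Y) * \<phi> (restr G Y))"
      using insert assms by (intro step[of "G \<union> K" e "\<lambda>Y. \<phi> (restr G Y)"]) auto
    finally show ?case using insert by simp
  qed
  from this[of "H - G"] show ?thesis
    using assms finite_ground by (simp add: finite_subset Un_absorb1)
qed

section \<open>Signed sums over the covectors of a restriction\<close>

text \<open>These are the topes of the restriction when \<open>F\<close> contains no loop; a loop in
  \<open>F\<close> makes the set empty.\<close>

definition restricted_topes :: "'a set \<Rightarrow> ('a \<Rightarrow> int) set" where
  "restricted_topes F = {B \<in> restrictions F. \<forall>e\<in>F. B e \<noteq> 0}"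

text \<open>Each coordinate contributes a factor \<open>(1 - q) * of_bool (X e = A e) + q\<close>.
  Expanding the product gives terms indexed by \<open>U \<subseteq> F\<close> that see only the
  restriction of \<open>X\<close> to \<open>U\<close>. Pushed forward to \<open>U\<close>, only the
  restriction of the tope \<open>A\<close> survives, with sign 1, and the coefficients
  \<open>c U\<close> add up to \<open>(1 - q + q) ^ card F\<close>.\<close>

lemma sum_rank_sign_disagreement:
  fixes q :: "rat fps"
  assumes F: "F \<subseteq> E" and A: "A \<in> restricted_topes F"
  shows "(\<Sum>X\<in>restrictions F. rank_sign (zero_set F X) * q ^ card {e \<in> F. X e \<noteq> A e}) = 1"
proof -
  have fin: "finite F" using F finite_ground finite_subset by blast
  define c where "c U = (1 - q) ^ card U * q ^ card (F - U)" for U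
  have expand: "q ^ card {e \<in> F. X e \<noteq> A e} =
      (\<Sum>U\<in>Pow F. c U * of_bool (restr U X = restr U A))" for X
  proof -
    have "q ^ card {e \<in> F. X e \<noteq> A e} = (\<Prod>e\<in>F. if X e = A e then 1 else q)"
      using fin by (simp add: prod.If_cases Int_def)
    also have "\<dots> = (\<Prod>e\<in>F. (1 - q) * of_bool (X e = A e) + q)"
      by (intro prod.cong) auto
    also have "\<dots> = (\<Sum>U\<in>Pow F. c U * of_bool (restr U X = restr U A))"
      unfolding prod_add[OF fin]
    proof (intro sum.cong refl)
      fix U assume "U \<in> Pow F"
      then have "finite U" using fin finite_subset by blast
      moreover have "restr U X = restr U A \<longleftrightarrow> (\<forall>e\<in>U. X e = A e)"
        by (auto simp: restr_def fun_eq_iff)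
      ultimately show "(\<Prod>e\<in>U. (1 - q) * of_bool (X e = A e)) * (\<Prod>e\<in>F - U. q) =
          c U * of_bool (restr U X = restr U A)"
        by (simp add: c_def prod.distrib prod_of_bool)
    qed
    finally show ?thesis .
  qed
  have inner: "(\<Sum>X\<in>restrictions F. rank_sign (zero_set F X) * of_bool (restr U X = restr U A)) = 1"
    if U: "U \<subseteq> F" for U
  proof -
    have "(\<Sum>X\<in>restrictions F. rank_sign (zero_set F X) * of_bool (restr U X = restr U A)) =
        (\<Sum>Y\<in>restrictions U. rank_sign (zero_set U Y) * of_bool (Y = restr U A))"
      by (rule pushforward[OF U F])
    also have "\<dots> = rank_sign (zero_set U (restr U A))"
      using A U finite_restrictions restr_in_restrictions by (intro sum_of_bool_eq) (auto simp: restricted_topes_def)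
    also have "zero_set U (restr U A) = {}"
      using A U by (auto simp: zero_set_def restr_def restricted_topes_def)
    finally show ?thesis
      using matroid.rank_indep[OF matroid_indep matroid.indep_empty[OF matroid_indep]]
      by (simp add: rank_sign_def)
  qed
  have "(\<Sum>X\<in>restrictions F. rank_sign (zero_set F X) * q ^ card {e \<in> F. X e \<noteq> A e}) =
      (\<Sum>X\<in>restrictions F. \<Sum>U\<in>Pow F. c U * (rank_sign (zero_set F X) * of_bool (restr U X = restr U A)))"
    unfolding expand sum_distrib_left by (simp add: mult_ac)
  also have "\<dots> = (\<Sum>U\<in>Pow F. c U * (\<Sum>X\<in>restrictions F. rank_sign (zero_set F X) * of_bool (restr U X = restr U A)))"
    unfolding sum_distrib_left by (rule sum.swap)
  also have "\<dots> = (\<Sum>U\<in>Pow F. (\<Prod>e\<in>U. 1 - q) * (\<Prod>e\<in>F - U. q))"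
    by (intro sum.cong) (auto simp: inner c_def)
  also have "\<dots> = 1" unfolding prod_add[OF fin, symmetric] by simp
  finally show ?thesis .
qed

text \<open>The condition concerns only the restriction to \<open>S\<close>, where it selects the
  zero covector.\<close>

lemma sum_rank_sign_above:
  assumes "S \<subseteq> F" "F \<subseteq> E"
  shows "(\<Sum>X\<in>restrictions F. rank_sign (zero_set F X) * of_bool (S \<subseteq> zero_set F X)) = rank_sign S"
proof -
  have "S \<subseteq> zero_set F X \<longleftrightarrow> restr S X = (\<lambda>_. 0)" for X
    using assms by (auto simp: zero_set_def restr_def fun_eq_iff)
  then have "(\<Sum>X\<in>restrictions F. rank_sign (zero_set F X) * of_bool (S \<subseteq> zero_set F X)) =
      (\<Sum>Y\<in>restrictions S. rank_sign (zero_set S Y) * of_bool (Y = (\<lambda>_. 0)))"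
    using pushforward[OF assms, of "\<lambda>Y. of_bool (Y = (\<lambda>_. 0))"] by simp
  also have "\<dots> = rank_sign (zero_set S (\<lambda>_. 0))"
    by (intro sum_of_bool_eq finite_restrictions zero_in_restrictions)
  finally show ?thesis by (simp add: zero_set_def)
qed

text \<open>Inclusion-exclusion over the elements of \<open>F - H\<close> that have to stay out of
  the zero set. The result involves ranks only, which is what connects sums over covectors with the
  recursion of the zeta function.\<close>

lemma sum_rank_sign_zero_set_eq:
  assumes "H \<subseteq> F" "F \<subseteq> E"
  shows "(\<Sum>X\<in>restrictions F. rank_sign (zero_set F X) * of_bool (zero_set F X = H)) =
    (\<Sum>S\<in>Pow (F - H). (-1) ^ card S * rank_sign (H \<union> S))"
proof -
  have fin: "finite (F - H)" using assms finite_ground finite_subset by blast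
  \<comment> \<open>The alternating sum factors as the product of
    \<open>1 - of_bool (e \<in> Z)\<close> over \<open>F - H\<close>, which detects
    \<open>Z \<subseteq> H\<close>.\<close>
  have inner: "of_bool (H \<subseteq> Z) * (\<Sum>S\<in>Pow (F - H). (-1) ^ card S * of_bool (S \<subseteq> Z)) =
      (of_bool (Z = H) :: rat fps)" if "Z \<subseteq> F" for Z
  proof -
    have "(\<Sum>S\<in>Pow (F - H). (-1) ^ card S * of_bool (S \<subseteq> Z)) =
        (\<Sum>S\<in>Pow (F - H). (\<Prod>e\<in>S. (-1) * of_bool (e \<in> Z)) * (\<Prod>e\<in>F - H - S. 1) :: rat fps)"
    proof (intro sum.cong refl)
      fix S assume "S \<in> Pow (F - H)"
      then have "finite S" using fin finite_subset by blast
      then show "(-1) ^ card S * of_bool (S \<subseteq> Z) =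
          ((\<Prod>e\<in>S. (-1) * of_bool (e \<in> Z)) * (\<Prod>e\<in>F - H - S. 1) :: rat fps)"
        unfolding prod.distrib by (simp add: prod_of_bool subset_eq)
    qed
    also have "\<dots> = (\<Prod>e\<in>F - H. of_bool (e \<notin> Z))"
      unfolding prod_add[OF fin, symmetric] by (intro prod.cong) auto
    also have "\<dots> = of_bool (Z \<subseteq> H)" using that by (auto simp: prod_of_bool[OF fin])
    finally show ?thesis by auto
  qed
  have "(\<Sum>S\<in>Pow (F - H). (-1) ^ card S * rank_sign (H \<union> S)) =
      (\<Sum>S\<in>Pow (F - H). (-1) ^ card S *
        (\<Sum>X\<in>restrictions F. rank_sign (zero_set F X) * of_bool (H \<union> S \<subseteq> zero_set F X)))"
    using assms by (intro sum.cong refl arg_cong2[where f = "(*)"] sum_rank_sign_above[symmetric]) auto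
  also have "\<dots> = (\<Sum>X\<in>restrictions F. \<Sum>S\<in>Pow (F - H). (-1) ^ card S *
      (rank_sign (zero_set F X) * of_bool (H \<union> S \<subseteq> zero_set F X)))"
    unfolding sum_distrib_left by (rule sum.swap)
  also have "\<dots> = (\<Sum>X\<in>restrictions F. rank_sign (zero_set F X) * (of_bool (H \<subseteq> zero_set F X) *
      (\<Sum>S\<in>Pow (F - H). (-1) ^ card S * of_bool (S \<subseteq> zero_set F X))))"
    unfolding sum_distrib_left by (intro sum.cong refl) (auto simp: of_bool_conj)
  also have "\<dots> = (\<Sum>X\<in>restrictions F. rank_sign (zero_set F X) * of_bool (zero_set F X = H))"
    by (subst inner) (auto simp: zero_set_def)
  finally show ?thesis by simp
qed

end

section \<open>A weighting on the topes\<close>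

context oriented_matroid
begin

lemma sign_comp_in_restrictions:
  assumes "X \<in> restrictions F" "Y \<in> restrictions (zero_set F X)"
  shows "sign_comp X Y \<in> restrictions F"
proof -
  obtain X' Y' where X': "X' \<in> L" "X = restr F X'" and Y': "Y' \<in> L" "Y = restr (zero_set F X) Y'"
    using assms by (auto simp: restrictions_def)
  have "sign_comp X Y = restr F (sign_comp X' Y')"
  proof
    fix e
    have "X e = (if e \<in> F then X' e else 0)" "Y e = (if e \<in> zero_set F X then Y' e else 0)"
      using X'(2) Y'(2) by (simp_all add: restr_def)
    then show "sign_comp X Y e = restr F (sign_comp X' Y') e"
      by (auto simp: sign_comp_def restr_def zero_set_def)
  qed
  then show ?thesis using comp_covector[OF X'(1) Y'(1)] by (auto simp: restrictions_def)
qed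

text \<open>A tope above \<open>X\<close> is free only on the zero set of \<open>X\<close>;
  restriction to that set and composition with \<open>X\<close> are mutually inverse.\<close>

lemma sum_topes_above:
  assumes X: "X \<in> restrictions F"
  shows "(\<Sum>B\<in>{B \<in> restricted_topes F. covector_le X B}. h B) =
    (\<Sum>Y\<in>restricted_topes (zero_set F X). h (sign_comp X Y))"
proof (rule sum.reindex_bij_witness[where i = "sign_comp X" and j = "restr (zero_set F X)"])
  fix B assume "B \<in> {B \<in> restricted_topes F. covector_le X B}"
  then have B: "B \<in> restrictions F" "\<forall>e\<in>F. B e \<noteq> 0" "\<forall>e. X e = 0 \<or> X e = B e"
    by (auto simp: restricted_topes_def covector_le_def)
  show *: "sign_comp X (restr (zero_set F X) B) = B"
  proof
    fix e show "sign_comp X (restr (zero_set F X) B) e = B e"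
      using B(3) restrictions_outside[OF B(1), of e]
      by (cases "X e = 0") (auto simp: sign_comp_def restr_def zero_set_def)
  qed
  show "restr (zero_set F X) B \<in> restricted_topes (zero_set F X)"
    using B restr_in_restrictions[OF B(1), of "zero_set F X"] by (auto simp: restricted_topes_def zero_set_def restr_def)
  show "h (sign_comp X (restr (zero_set F X) B)) = h B" by (simp add: *)
next
  fix Y assume "Y \<in> restricted_topes (zero_set F X)"
  then have Y: "Y \<in> restrictions (zero_set F X)" "\<forall>e\<in>zero_set F X. Y e \<noteq> 0" by (auto simp: restricted_topes_def)
  show "restr (zero_set F X) (sign_comp X Y) = Y"
  proof
    fix e show "restr (zero_set F X) (sign_comp X Y) e = Y e"
      using restrictions_outside[OF Y(1), of e] by (auto simp: sign_comp_def restr_def zero_set_def)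
  qed
  show "sign_comp X Y \<in> {B \<in> restricted_topes F. covector_le X B}"
    using sign_comp_in_restrictions[OF X Y(1)] Y(2)
    by (auto simp: restricted_topes_def sign_comp_def zero_set_def covector_le_def)
qed

lemma finite_restricted_topes: "finite (restricted_topes F)"
  using finite_restrictions by (simp add: restricted_topes_def)

text \<open>Off the zero set of \<open>X\<close> the tope \<open>A\<close> is compared with
  \<open>X\<close>, on it with \<open>Y\<close>. Hence the kernel
  \<open>q ^ card (separation A B)\<close> factors along faces, which drives the induction in
  \<open>ex_weighting\<close>.\<close>

lemma card_separation_comp:
  assumes "F \<subseteq> E" "A \<in> restricted_topes F" "X \<in> restrictions F" "Y \<in> restrictions (zero_set F X)"
  shows "card (separation A (sign_comp X Y)) =
    card (separation A X) + card (separation (restr (zero_set F X) A) Y)"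
proof -
  have A: "A \<in> restrictions F" using assms by (simp add: restricted_topes_def)
  have fin: "finite F" using assms finite_ground finite_subset by blast
  have "separation A (sign_comp X Y) = separation A X \<union> separation (restr (zero_set F X) A) Y"
  proof (rule set_eqI)
    fix e show "e \<in> separation A (sign_comp X Y) \<longleftrightarrow>
        e \<in> separation A X \<union> separation (restr (zero_set F X) A) Y"
      using restrictions_outside[OF A, of e] restrictions_outside[OF assms(4), of e]
      by (auto simp: separation_def sign_comp_def restr_def zero_set_def)
  qed
  moreover have "separation A X \<inter> separation (restr (zero_set F X) A) Y = {}"
    by (auto simp: separation_def restr_def zero_set_def)
  moreover have "finite (separation A X)" "finite (separation (restr (zero_set F X) A) Y)"
    using restrictions_outside[OF A] by (auto intro!: finite_subset[OF _ fin] simp: separation_def restr_def zero_set_def)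
  ultimately show ?thesis by (simp add: card_Un_disjoint)
qed

text \<open>Where \<open>X\<close> differs from a tope it is either zero or opposite. This matches
  the exponent in \<open>sum_rank_sign_disagreement\<close> with the one that the weighting
  produces.\<close>

lemma card_disagreement:
  assumes "F \<subseteq> E" "A \<in> restricted_topes F" "X \<in> restrictions F"
  shows "card {e \<in> F. X e \<noteq> A e} = card (zero_set F X) + card (separation A X)"
proof -
  have A: "A \<in> restrictions F" "\<forall>e\<in>F. A e \<noteq> 0" using assms by (auto simp: restricted_topes_def)
  have fin: "finite F" using assms finite_ground finite_subset by blast
  have "{e \<in> F. X e \<noteq> A e} = zero_set F X \<union> separation A X"
  proof (rule set_eqI)
    fix e show "e \<in> {e \<in> F. X e \<noteq> A e} \<longleftrightarrow> e \<in> zero_set F X \<union> separation A X"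
    proof (cases "e \<in> F")
      case True
      then have "A e = -1 \<or> A e = 1" "X e = -1 \<or> X e = 0 \<or> X e = 1"
        using A(2) restrictions_sign[OF A(1), of e] restrictions_sign[OF assms(3), of e] by blast+
      then show ?thesis using True by (elim disjE) (simp_all add: zero_set_def separation_def)
    next
      case False
      then show ?thesis using restrictions_outside[OF A(1)] by (simp add: zero_set_def separation_def)
    qed
  qed
  moreover have "zero_set F X \<inter> separation A X = {}"
    by (auto simp: zero_set_def separation_def)
  moreover have "finite (zero_set F X)" "finite (separation A X)"
    using restrictions_outside[OF A(1)] by (auto intro!: finite_subset[OF _ fin] simp: separation_def zero_set_def)
  ultimately show ?thesis by (simp add: card_Un_disjoint)
qed

lemma restricted_topes_empty: "restricted_topes {} = {\<lambda>_. 0}"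
proof -
  have "restr {} X = (\<lambda>_. 0)" for X by (simp add: restr_def)
  then have "restrictions {} = {\<lambda>_. 0}" using zero_covector by (auto simp: restrictions_def)
  then show ?thesis by (simp add: restricted_topes_def)
qed

text \<open>The series \<open>\<zeta>\<close> enters only through its recursion, which separates the
  argument about covectors from the zeta function. The induction runs over subsets because the
  weighting for \<open>F\<close> is assembled from those for zero sets of covectors.\<close>

lemma ex_weighting:
  fixes \<zeta> :: "'a set \<Rightarrow> rat fps"
  assumes \<zeta>_empty: "\<zeta> {} = 1"
    and \<zeta>_rec: "\<And>G. G \<subseteq> E \<Longrightarrow> \<zeta> G = (\<Sum>H\<in>Pow G. fps_X ^ card H * \<zeta> H *
      (\<Sum>S\<in>Pow (G - H). (-1) ^ card S * rank_sign (H \<union> S)))"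
    and "F \<subseteq> E"
  shows "\<exists>v. (\<forall>A\<in>restricted_topes F. (\<Sum>B\<in>restricted_topes F. fps_X ^ card (separation A B) * v B) = 1) \<and>
    (\<Sum>B\<in>restricted_topes F. v B) = \<zeta> F"
  using \<open>F \<subseteq> E\<close>
proof (induction "card F" arbitrary: F rule: less_induct)
  case less
  have fin: "finite F" using less.prems finite_ground finite_subset by blast
  show ?case
  proof (cases "F = {}")
    case True
    then show ?thesis
      by (intro exI[of _ "\<lambda>_. 1"]) (simp add: restricted_topes_empty separation_def \<zeta>_empty)
  next
    case False
    let ?q = "fps_X :: rat fps"
    have "\<exists>v. (\<forall>A\<in>restricted_topes H. (\<Sum>B\<in>restricted_topes H. ?q ^ card (separation A B) * v B) = 1) \<and>
        (\<Sum>B\<in>restricted_topes H. v B) = \<zeta> H" if "H \<subset> F" for H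
      using that less by (simp add: psubset_card_mono fin psubset_imp_subset subset_trans)
    then have "\<forall>H. \<exists>v. H \<subset> F \<longrightarrow>
        (\<forall>A\<in>restricted_topes H. (\<Sum>B\<in>restricted_topes H. ?q ^ card (separation A B) * v B) = 1) \<and>
        (\<Sum>B\<in>restricted_topes H. v B) = \<zeta> H" by (simp only: ex_simps) simp
    from choice[OF this] obtain u where u': "\<forall>H. H \<subset> F \<longrightarrow>
        (\<forall>A\<in>restricted_topes H. (\<Sum>B\<in>restricted_topes H. ?q ^ card (separation A B) * u H B) = 1) \<and>
        (\<Sum>B\<in>restricted_topes H. u H B) = \<zeta> H" ..
    have u: "(\<Sum>B\<in>restricted_topes H. ?q ^ card (separation A B) * u H B) = 1" if "H \<subset> F" "A \<in> restricted_topes H" for H A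
      using u' that by simp
    have u_sum: "(\<Sum>B\<in>restricted_topes H. u H B) = \<zeta> H" if "H \<subset> F" for H
      using u' that by simp
    \<comment> \<open>The nonzero covectors are those with a proper zero set, to which the induction
      hypothesis applies.\<close>
    define P where "P = restrictions F - {\<lambda>_. 0}"
    \<comment> \<open>In the recursive formula for \<open>v B\<close> the covector \<open>0\<close>
      contributes \<open>rank_sign F * ?q ^ card F * v B\<close>. Moving it to the left gives
      \<open>D * v B = num B\<close>, and \<open>D\<close> is invertible because \<open>F\<close> is
      nonempty.\<close>
    define D where "D = 1 - rank_sign F * ?q ^ card F"
    have finP: "finite P" using finite_restrictions by (simp add: P_def)
    have P: "X \<in> restrictions F" "zero_set F X \<subset> F" if XP: "X \<in> P" for X
    proof -
      show X: "X \<in> restrictions F" using XP by (simp add: P_def)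
      obtain e where "X e \<noteq> 0" using XP by (auto simp: P_def fun_eq_iff)
      then show "zero_set F X \<subset> F" using restrictions_outside[OF X] by (auto simp: zero_set_def)
    qed
    have "card F > 0" using fin False by (simp add: card_gt_0_iff)
    then have "fps_nth D 0 = 1" by (simp add: D_def)
    then have D: "D * inverse D = 1" by (intro inverse_mult_eq_1') simp
    define num where "num B = (\<Sum>X\<in>P. of_bool (covector_le X B) *
        (rank_sign (zero_set F X) * ?q ^ card (zero_set F X) * u (zero_set F X) (restr (zero_set F X) B)))"
      for B
    define v where "v B = num B * inverse D" for B
    \<comment> \<open>Used twice: with \<open>g B = ?q ^ card (separation A B)\<close> for the
      weighting equation and with \<open>g = 1\<close> for the total.\<close>
    have num_sum: "(\<Sum>B\<in>restricted_topes F. g B * num B) = (\<Sum>X\<in>P. rank_sign (zero_set F X) * ?q ^ card (zero_set F X) *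
        (\<Sum>Y\<in>restricted_topes (zero_set F X). g (sign_comp X Y) * u (zero_set F X) Y))" for g
    proof -
      have "(\<Sum>B\<in>restricted_topes F. g B * num B) = (\<Sum>B\<in>restricted_topes F. \<Sum>X\<in>P. of_bool (covector_le X B) *
          (rank_sign (zero_set F X) * ?q ^ card (zero_set F X) *
            (g B * u (zero_set F X) (restr (zero_set F X) B))))"
        unfolding num_def sum_distrib_left by (simp add: mult_ac)
      also have "\<dots> = (\<Sum>X\<in>P. \<Sum>B\<in>restricted_topes F. of_bool (covector_le X B) *
          (rank_sign (zero_set F X) * ?q ^ card (zero_set F X) *
            (g B * u (zero_set F X) (restr (zero_set F X) B))))"
        by (rule sum.swap)
      also have "\<dots> = (\<Sum>X\<in>P. rank_sign (zero_set F X) * ?q ^ card (zero_set F X) *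
        (\<Sum>Y\<in>restricted_topes (zero_set F X). g (sign_comp X Y) * u (zero_set F X) Y))"
      proof (rule sum.cong[OF refl])
        fix X assume X: "X \<in> P"
        let ?z = "zero_set F X"
        have "(\<Sum>B\<in>restricted_topes F. of_bool (covector_le X B) *
            (rank_sign ?z * ?q ^ card ?z * (g B * u ?z (restr ?z B)))) =
            (\<Sum>B\<in>{B \<in> restricted_topes F. covector_le X B}.
              (rank_sign ?z * ?q ^ card ?z * (g B * u ?z (restr ?z B))))"
          using finite_restricted_topes by (intro sum.mono_neutral_cong_right) auto
        also have "\<dots> = (\<Sum>Y\<in>restricted_topes ?z. rank_sign ?z * ?q ^ card ?z *
            (g (sign_comp X Y) * u ?z (restr ?z (sign_comp X Y))))"
          by (rule sum_topes_above[OF P(1)[OF X]])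
        also have "\<dots> = (\<Sum>Y\<in>restricted_topes ?z. rank_sign ?z * ?q ^ card ?z * (g (sign_comp X Y) * u ?z Y))"
        proof (rule sum.cong[OF refl])
          fix Y assume "Y \<in> restricted_topes ?z"
          then have "restr ?z (sign_comp X Y) = Y"
            using restrictions_outside[of Y ?z] by (auto simp: restricted_topes_def restr_def sign_comp_def zero_set_def fun_eq_iff)
          then show "rank_sign ?z * ?q ^ card ?z * (g (sign_comp X Y) * u ?z (restr ?z (sign_comp X Y))) =
              rank_sign ?z * ?q ^ card ?z * (g (sign_comp X Y) * u ?z Y)" by simp
        qed
        finally show "(\<Sum>B\<in>restricted_topes F. of_bool (covector_le X B) *
            (rank_sign ?z * ?q ^ card ?z * (g B * u ?z (restr ?z B)))) =
            rank_sign ?z * ?q ^ card ?z * (\<Sum>Y\<in>restricted_topes ?z. g (sign_comp X Y) * u ?z Y)"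
          by (simp add: sum_distrib_left)
      qed
      finally show ?thesis .
    qed
    have zero_F: "zero_set F (\<lambda>_. 0) = F" by (simp add: zero_set_def)
    have one: "(\<Sum>B\<in>restricted_topes F. ?q ^ card (separation A B) * v B) = 1" if A: "A \<in> restricted_topes F" for A
    proof -
      \<comment> \<open>By the factored kernel and the induction hypothesis, the inner sum for
        \<open>X\<close> collapses to \<open>?q ^ card (separation A X)\<close>. What remains is the
        disagreement sum without its term for \<open>X = 0\<close>, and this equals
        \<open>D\<close>.\<close>
      have "(\<Sum>B\<in>restricted_topes F. ?q ^ card (separation A B) * num B) =
          (\<Sum>X\<in>P. rank_sign (zero_set F X) * ?q ^ card {e \<in> F. X e \<noteq> A e})"
        unfolding num_sum
      proof (rule sum.cong[OF refl])
        fix X assume X: "X \<in> P"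
        let ?z = "zero_set F X"
        have "restr ?z A \<in> restricted_topes ?z"
          using A restr_in_restrictions[of A F ?z] by (auto simp: restricted_topes_def restr_def zero_set_def)
        then have "(\<Sum>Y\<in>restricted_topes ?z. ?q ^ card (separation (restr ?z A) Y) * u ?z Y) = 1"
          by (rule u[OF P(2)[OF X]])
        moreover have "(\<Sum>Y\<in>restricted_topes ?z. ?q ^ card (separation A (sign_comp X Y)) * u ?z Y) =
            ?q ^ card (separation A X) *
              (\<Sum>Y\<in>restricted_topes ?z. ?q ^ card (separation (restr ?z A) Y) * u ?z Y)"
          unfolding sum_distrib_left
        proof (rule sum.cong[OF refl])
          fix Y assume "Y \<in> restricted_topes ?z"
          then have "Y \<in> restrictions ?z" by (simp add: restricted_topes_def)
          from card_separation_comp[OF less.prems A P(1)[OF X] this]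
          show "?q ^ card (separation A (sign_comp X Y)) * u ?z Y =
            ?q ^ card (separation A X) * (?q ^ card (separation (restr ?z A) Y) * u ?z Y)"
            by (simp add: power_add mult.assoc)
        qed
        ultimately show "rank_sign ?z * ?q ^ card ?z *
            (\<Sum>Y\<in>restricted_topes ?z. ?q ^ card (separation A (sign_comp X Y)) * u ?z Y) =
            rank_sign ?z * ?q ^ card {e \<in> F. X e \<noteq> A e}"
          unfolding card_disagreement[OF less.prems A P(1)[OF X]] by (simp add: power_add mult.assoc)
      qed
      also have "\<dots> = (\<Sum>X\<in>restrictions F. rank_sign (zero_set F X) * ?q ^ card {e \<in> F. X e \<noteq> A e}) -
          rank_sign F * ?q ^ card {e \<in> F. 0 \<noteq> A e}"
        unfolding P_def using finite_restrictions zero_in_restrictions by (simp add: sum_diff1 zero_F)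
      also have "{e \<in> F. 0 \<noteq> A e} = F" using A by (auto simp: restricted_topes_def)
      finally have "(\<Sum>B\<in>restricted_topes F. ?q ^ card (separation A B) * num B) = D"
        unfolding sum_rank_sign_disagreement[OF less.prems A] D_def .
      then show ?thesis using D by (simp add: v_def mult.assoc[symmetric] sum_distrib_right[symmetric])
    qed
    have "(\<Sum>B\<in>restricted_topes F. num B) = (\<Sum>X\<in>P. rank_sign (zero_set F X) * ?q ^ card (zero_set F X) * \<zeta> (zero_set F X))"
      using num_sum[of "\<lambda>_. 1"] u_sum P by simp
    also have "\<dots> = (\<Sum>X\<in>restrictions F. rank_sign (zero_set F X) * ?q ^ card (zero_set F X) * \<zeta> (zero_set F X)) -
        rank_sign F * ?q ^ card F * \<zeta> F"
      unfolding P_def using finite_restrictions zero_in_restrictions by (simp add: sum_diff1 zero_F)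
    \<comment> \<open>Grouping the covectors by zero set reproduces the right side of the recursion,
      so the full sum is \<open>\<zeta> F\<close>. The subtracted term for \<open>X = 0\<close>
      leaves \<open>\<zeta> F * D\<close>.\<close>
    also have "(\<Sum>X\<in>restrictions F. rank_sign (zero_set F X) * ?q ^ card (zero_set F X) * \<zeta> (zero_set F X)) =
        (\<Sum>X\<in>restrictions F. \<Sum>H\<in>Pow F. ?q ^ card H * \<zeta> H * (rank_sign (zero_set F X) * of_bool (zero_set F X = H)))"
    proof (rule sum.cong[OF refl])
      fix X
      have "(\<Sum>H\<in>Pow F. ?q ^ card H * \<zeta> H * rank_sign (zero_set F X) * of_bool (H = zero_set F X)) =
        ?q ^ card (zero_set F X) * \<zeta> (zero_set F X) * rank_sign (zero_set F X)"
        using fin by (intro sum_of_bool_eq) (auto simp: zero_set_def)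
      then show "rank_sign (zero_set F X) * ?q ^ card (zero_set F X) * \<zeta> (zero_set F X) =
          (\<Sum>H\<in>Pow F. ?q ^ card H * \<zeta> H * (rank_sign (zero_set F X) * of_bool (zero_set F X = H)))"
        by (simp add: mult_ac eq_commute[of _ "zero_set F X"])
    qed
    also have "\<dots> = (\<Sum>H\<in>Pow F. ?q ^ card H * \<zeta> H *
        (\<Sum>X\<in>restrictions F. rank_sign (zero_set F X) * of_bool (zero_set F X = H)))"
      unfolding sum_distrib_left by (rule sum.swap)
    also have "\<dots> = \<zeta> F"
      unfolding \<zeta>_rec[OF less.prems] using less.prems
      by (intro sum.cong refl arg_cong2[where f = "(*)"] sum_rank_sign_zero_set_eq) auto
    finally have "(\<Sum>B\<in>restricted_topes F. num B) = \<zeta> F * D" by (simp add: D_def algebra_simps)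
    then have "(\<Sum>B\<in>restricted_topes F. v B) = \<zeta> F"
      using D by (simp add: v_def mult.assoc sum_distrib_right[symmetric])
    then show ?thesis using one by blast
  qed
qed

end

section \<open>The motivic zeta function at minus one\<close>

lemma laurent_at_minus_one_eq:
  assumes "finite K" "Poly_Mapping.keys p \<subseteq> K"
  shows "laurent_at_minus_one p = (\<Sum>k\<in>K. Poly_Mapping.lookup p k * (if even k then 1 else -1))"
  unfolding laurent_at_minus_one_def
  by (rule sum.mono_neutral_left[OF assms]) (auto simp: in_keys_iff)

lemma laurent_at_minus_one_add:
  "laurent_at_minus_one (p + q) = laurent_at_minus_one p + laurent_at_minus_one q"
proof -
  let ?K = "Poly_Mapping.keys p \<union> Poly_Mapping.keys q"
  have fin: "finite ?K" by simp
  show ?thesis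
    unfolding laurent_at_minus_one_eq[OF fin Poly_Mapping.keys_add]
      laurent_at_minus_one_eq[OF fin Un_upper1] laurent_at_minus_one_eq[OF fin Un_upper2]
    by (simp add: lookup_add sum.distrib algebra_simps)
qed

lemma laurent_at_minus_one_sum:
  "laurent_at_minus_one (\<Sum>x\<in>A. f x) = (\<Sum>x\<in>A. laurent_at_minus_one (f x))"
proof (induction A rule: infinite_finite_induct)
  case (insert x A)
  then show ?case by (simp add: laurent_at_minus_one_add)
qed (simp_all add: laurent_at_minus_one_def)

lemma laurent_at_minus_one_single:
  "laurent_at_minus_one (Poly_Mapping.single k c) = c * (if even k then 1 else -1)"
  by (simp add: laurent_at_minus_one_def)

lemma laurent_x_pow_power: "laurent_x_pow 1 ^ n = laurent_x_pow (int n)"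
  by (induction n) (simp_all add: laurent_x_pow_def Poly_Mapping.mult_single)

lemma laurent_monomial:
  "(-1) ^ m * laurent_x_pow 1 ^ a * laurent_x_pow k = Poly_Mapping.single (int a + k) ((-1) ^ m)"
  unfolding laurent_x_pow_power
  by (simp add: laurent_x_pow_def Poly_Mapping.mult_single minus_one_power_iff
      Poly_Mapping.single_uminus)

section \<open>Weight vectors sorted by support\<close>

definition weights :: "'a set \<Rightarrow> nat \<Rightarrow> ('a \<Rightarrow> nat) set" where
  "weights F n = {w. (\<forall>e. e \<notin> F \<longrightarrow> w e = 0) \<and> (\<Sum>e\<in>F. w e) = n}"

lemma finite_weights:
  assumes "finite F"
  shows "finite (weights F n)"
proof -
  have "w e \<le> n" if "w \<in> weights F n" "e \<in> F" for w e
    using that member_le_sum[of e F w] assms by (auto simp: weights_def)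
  then have "weights F n \<subseteq> {w. \<forall>e. (e \<in> F \<longrightarrow> w e \<in> {..n}) \<and> (e \<notin> F \<longrightarrow> w e = 0)}"
    by (auto simp: weights_def)
  then show ?thesis
    using finite_set_of_finite_funs[OF assms, of "{..n}" 0] finite_subset by blast
qed

text \<open>A vector with support \<open>H\<close> is the indicator of \<open>H\<close> plus an
  arbitrary vector on \<open>H\<close> whose sum is smaller by \<open>card H\<close>. No such vector
  exists when \<open>n < card H\<close>.\<close>

lemma sum_weights_support:
  assumes "finite G" "H \<subseteq> G"
  shows "(\<Sum>w\<in>{w \<in> weights G n. {e \<in> G. w e \<noteq> 0} = H}. g w) =
    (if n < card H then 0 else \<Sum>w\<in>weights H (n - card H). g (\<lambda>e. of_bool (e \<in> H) + w e))"
proof -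
  have finH: "finite H" using assms finite_subset by blast
  have shift: "(\<Sum>e\<in>G. w e) = card H + (\<Sum>e\<in>H. w e - 1)"
    if "w \<in> weights G n" "{e \<in> G. w e \<noteq> 0} = H" for w
  proof -
    have "(\<Sum>e\<in>G. w e) = (\<Sum>e\<in>H. w e)"
      using that assms by (intro sum.mono_neutral_right) auto
    also have "\<dots> = (\<Sum>e\<in>H. 1 + (w e - 1))" using that by (intro sum.cong) auto
    also have "\<dots> = card H + (\<Sum>e\<in>H. w e - 1)" unfolding sum.distrib by simp
    finally show ?thesis .
  qed
  show ?thesis
  proof (cases "n < card H")
    case True
    have "{w \<in> weights G n. {e \<in> G. w e \<noteq> 0} = H} = {}"
    proof -
      have False if w: "w \<in> weights G n" "{e \<in> G. w e \<noteq> 0} = H" for w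
        using shift[OF w] w(1) True by (simp add: weights_def)
      then show ?thesis by blast
    qed
    then show ?thesis using True by (simp only:) simp
  next
    case False
    have "(\<Sum>w\<in>{w \<in> weights G n. {e \<in> G. w e \<noteq> 0} = H}. g w) =
        (\<Sum>w\<in>weights H (n - card H). g (\<lambda>e. of_bool (e \<in> H) + w e))"
    \<comment> \<open>Truncated subtraction of 1 undoes the indicator: it is exact on the support
      and stays at 0 elsewhere.\<close>
    proof (rule sum.reindex_bij_witness[where i = "\<lambda>w e. of_bool (e \<in> H) + w e"
          and j = "\<lambda>w e. w e - 1"])
      fix w assume w: "w \<in> {w \<in> weights G n. {e \<in> G. w e \<noteq> 0} = H}"
      show *: "(\<lambda>e. of_bool (e \<in> H) + (w e - 1)) = w"
      proof
        fix e show "of_bool (e \<in> H) + (w e - 1) = w e"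
          using w by (cases "e \<in> H") (auto simp: weights_def)
      qed
      show "(\<lambda>e. w e - 1) \<in> weights H (n - card H)"
        using w shift[of w] by (auto simp: weights_def)
      show "g (\<lambda>e. of_bool (e \<in> H) + (w e - 1)) = g w" by (simp only: *)
    next
      fix w assume w: "w \<in> weights H (n - card H)"
      show "(\<lambda>e. of_bool (e \<in> H) + w e - 1) = w"
        using w by (auto simp: weights_def fun_eq_iff)
      have "(\<Sum>e\<in>G. of_bool (e \<in> H) + w e) = (\<Sum>e\<in>H. 1 + w e)"
        using assms w by (intro sum.mono_neutral_cong_right) (auto simp: weights_def)
      also have "\<dots> = n" using w False unfolding sum.distrib by (simp add: weights_def)
      finally show "(\<lambda>e. of_bool (e \<in> H) + w e) \<in>
          {w \<in> weights G n. {e \<in> G. w e \<noteq> 0} = H}"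
        using w assms by (auto simp: weights_def split: if_splits)
    qed
    then show ?thesis using False by simp
  qed
qed

lemma sum_Pow_split:
  assumes "H \<subseteq> G"
  shows "(\<Sum>S\<in>Pow G. f S) = (\<Sum>S2\<in>Pow (G - H). \<Sum>S1\<in>Pow H. f (S1 \<union> S2))"
  unfolding sum.cartesian_product
  by (rule sum.reindex_bij_witness[where i = "\<lambda>(S2, S1). S1 \<union> S2" and j = "\<lambda>S. (S - H, S \<inter> H)"])
    (use assms in \<open>auto simp: Un_commute Int_absorb1 intro: arg_cong[where f = f]\<close>)

section \<open>The recursion of the zeta function\<close>

context oriented_matroid
begin

text \<open>For \<open>F = E\<close> this is the contribution of \<open>w\<close> to the zeta
  function at minus one. The weight is taken in the whole matroid also for smaller \<open>F\<close>,
  which the recursion needs.\<close>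

definition weight_sum :: "'a set \<Rightarrow> ('a \<Rightarrow> nat) \<Rightarrow> rat" where
  "weight_sum F w = (\<Sum>S\<in>Pow F. (-1) ^ (card S + matroid_wt indep (\<lambda>e. of_bool (e \<in> S) + w e)))"

definition zeta :: "'a set \<Rightarrow> rat fps" where
  "zeta F = Abs_fps (\<lambda>n. \<Sum>w\<in>weights F n. weight_sum F w)"

lemma underlying_eq: "underlying_matroid E L = indep"
proof -
  have "oriented_matroid E L" by (rule oriented_matroid_axioms)
  from underlying_matroid[OF this] show ?thesis
    using matroid_eqI[OF _ matroid_indep] flats_indep by metis
qed

lemma zeta_empty: "zeta {} = 1"
proof (rule fps_ext)
  fix n
  have "weights ({} :: 'a set) n = (if n = 0 then {\<lambda>_. 0} else {})"
    by (auto simp: weights_def fun_eq_iff)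
  then show "fps_nth (zeta {}) n = fps_nth 1 n"
    by (simp add: zeta_def weight_sum_def matroid.wt_zero[OF matroid_indep])
qed

text \<open>Split \<open>S\<close> into \<open>S1\<close> inside \<open>H\<close> and
  \<open>S2\<close> outside. The indicators of \<open>S\<close> and \<open>H\<close> regroup as
  those of \<open>H \<union> S2\<close> and \<open>S1\<close>. Since \<open>w\<close> plus the
  indicator of \<open>S1\<close> is supported on \<open>H\<close>, \<open>wt_indicator_add\<close>
  splits off the rank of \<open>H \<union> S2\<close>.\<close>

lemma weight_sum_shift:
  assumes "H \<subseteq> G" "G \<subseteq> E" "\<And>e. e \<notin> H \<Longrightarrow> w e = 0"
  shows "weight_sum G (\<lambda>e. of_bool (e \<in> H) + w e) =
    (\<Sum>S\<in>Pow (G - H). (-1) ^ (card S + rk (H \<union> S))) * weight_sum H w"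
proof -
  interpret M: matroid E indep by (rule matroid_indep)
  have fin: "finite G" using assms finite_ground finite_subset by blast
  have *: "(-1) ^ (card (S1 \<union> S2) + matroid_wt indep (\<lambda>e. of_bool (e \<in> S1 \<union> S2) + (of_bool (e \<in> H) + w e)))
      = (-1) ^ (card S2 + rk (H \<union> S2)) *
        ((-1) ^ (card S1 + matroid_wt indep (\<lambda>e. of_bool (e \<in> S1) + w e)) :: rat)"
    if S: "S2 \<in> Pow (G - H)" "S1 \<in> Pow H" for S1 S2
  proof -
    have "(\<lambda>e. of_bool (e \<in> S1 \<union> S2) + (of_bool (e \<in> H) + w e)) =
        (\<lambda>e. of_bool (e \<in> H \<union> S2) + (of_bool (e \<in> S1) + w e))"
      using S by (auto simp: fun_eq_iff)
    moreover have "matroid_wt indep (\<lambda>e. of_bool (e \<in> H \<union> S2) + (of_bool (e \<in> S1) + w e)) =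
        rk (H \<union> S2) + matroid_wt indep (\<lambda>e. of_bool (e \<in> S1) + w e)"
      using S assms by (intro M.wt_indicator_add) auto
    moreover have "card (S1 \<union> S2) = card S1 + card S2"
      using S assms fin by (intro card_Un_disjoint) (auto intro: finite_subset)
    ultimately show ?thesis by (simp add: power_add)
  qed
  show ?thesis
    unfolding weight_sum_def sum_Pow_split[OF assms(1)] sum_product
    by (intro sum.cong refl) (rule *)
qed

lemma minus_one_power_fps: "(-1) ^ n = fps_const ((-1) ^ n :: rat)"
  by (simp add: minus_one_power_iff fps_const_neg[symmetric] del: fps_const_neg)

text \<open>Sorting the vectors by support \<open>H\<close> produces the factor
  \<open>fps_X ^ card H\<close>. The term \<open>H = G\<close> contains \<open>zeta G\<close> again,
  mirroring the term of the zero covector in \<open>ex_weighting\<close>.\<close>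

lemma zeta_rec:
  assumes "G \<subseteq> E"
  shows "zeta G = (\<Sum>H\<in>Pow G. fps_X ^ card H * zeta H *
    (\<Sum>S\<in>Pow (G - H). (-1) ^ card S * rank_sign (H \<union> S)))"
proof (rule fps_ext)
  fix n
  have fin: "finite G" using assms finite_ground finite_subset by blast
  define c where "c H = (\<Sum>S\<in>Pow (G - H). (-1) ^ (card S + rk (H \<union> S)) :: rat)" for H
  have c: "(\<Sum>S\<in>Pow (G - H). (-1) ^ card S * rank_sign (H \<union> S)) = fps_const (c H)" for H
    unfolding rank_sign_def power_add[symmetric] minus_one_power_fps c_def
    by (rule fps_ext) (simp add: fps_sum_nth power_add)
  have "fps_nth (zeta G) n = (\<Sum>w\<in>weights G n. weight_sum G w)" by (simp add: zeta_def)
  also have "\<dots> = (\<Sum>H\<in>Pow G. \<Sum>w\<in>{w \<in> weights G n. {e \<in> G. w e \<noteq> 0} = H}. weight_sum G w)"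
    using fin by (intro sum.group[symmetric] finite_weights) auto
  also have "\<dots> = (\<Sum>H\<in>Pow G. fps_nth (fps_X ^ card H * zeta H * fps_const (c H)) n)"
  proof (rule sum.cong[OF refl])
    fix H assume H: "H \<in> Pow G"
    have "(\<Sum>w\<in>weights H (n - card H). weight_sum G (\<lambda>e. of_bool (e \<in> H) + w e)) =
        (\<Sum>w\<in>weights H (n - card H). c H * weight_sum H w)"
      using H assms by (intro sum.cong refl) (auto simp: weights_def c_def intro!: weight_sum_shift)
    then show "(\<Sum>w\<in>{w \<in> weights G n. {e \<in> G. w e \<noteq> 0} = H}. weight_sum G w) =
        fps_nth (fps_X ^ card H * zeta H * fps_const (c H)) n"
      using H
      by (subst sum_weights_support[OF fin])
        (auto simp: fps_X_power_mult_nth zeta_def sum_distrib_left mult.commute)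
  qed
  finally show "fps_nth (zeta G) n = fps_nth (\<Sum>H\<in>Pow G. fps_X ^ card H * zeta H *
    (\<Sum>S\<in>Pow (G - H). (-1) ^ card S * rank_sign (H \<union> S))) n"
    by (simp add: c fps_sum_nth)
qed

text \<open>In the term of \<open>w\<close> and \<open>S\<close>,
  \<open>rank_initial_matroid\<close> turns the whole exponent of \<open>x\<close> into minus the
  weight of \<open>w + 1\<^sub>S\<close>, so at minus one only the parity of that weight
  remains.\<close>

lemma motivic_zeta_minus_one_eq: "rat_fps_of_int_fps (motivic_zeta_minus_one E indep) = zeta E"
proof (rule fps_ext)
  fix n
  interpret M: matroid E indep by (rule matroid_indep)
  have val: "laurent_at_minus_one (matroid_chi E (initial_matroid indep w) (laurent_x_pow 1) *
        laurent_x_pow (- int (rk E) - int (matroid_wt indep w))) =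
      (\<Sum>S\<in>Pow E. (-1) ^ (card S + matroid_wt indep (\<lambda>e. of_bool (e \<in> S) + w e)))"
    if w: "w \<in> weights E n" for w
  proof -
    let ?r = "matroid_rank (initial_matroid indep w)"
    have rE: "?r E = rk E"
      using M.rank_initial_matroid[of E w] M.wt_indicator_add[of E w] w by (auto simp: weights_def)
    have exponent: "int (?r E - ?r S) + (- int (rk E) - int (matroid_wt indep w)) =
        - int (matroid_wt indep (\<lambda>e. of_bool (e \<in> S) + w e))" if "S \<subseteq> E" for S
    proof -
      \<comment> \<open>Monotonicity of the weight makes the truncated subtraction in
        \<open>matroid_chi\<close> exact.\<close>
      have "matroid_wt indep (\<lambda>e. of_bool (e \<in> S) + w e) \<le> matroid_wt indep (\<lambda>e. of_bool (e \<in> E) + w e)"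
        using that by (intro M.wt_mono) auto
      then have "?r S \<le> ?r E"
        using M.rank_initial_matroid[OF that, of w] M.rank_initial_matroid[of E w] by simp
      then show ?thesis using M.rank_initial_matroid[OF that, of w] rE by simp
    qed
    show ?thesis
      unfolding matroid_chi_def sum_distrib_right laurent_monomial laurent_at_minus_one_sum
      by (intro sum.cong refl) (auto simp: laurent_at_minus_one_single exponent minus_one_power_iff)
  qed
  have "fps_nth (motivic_zeta_minus_one E indep) n =
      (\<Sum>w\<in>weights E n. \<Sum>S\<in>Pow E. (-1) ^ (card S + matroid_wt indep (\<lambda>e. of_bool (e \<in> S) + w e)))"
    unfolding motivic_zeta_minus_one_def motivic_zeta_def fps_nth_Abs_fps laurent_at_minus_one_sum
      weights_def[symmetric]
    by (rule sum.cong[OF refl val])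
  then show "fps_nth (rat_fps_of_int_fps (motivic_zeta_minus_one E indep)) n = fps_nth (zeta E) n"
    by (simp add: rat_fps_of_int_fps_def zeta_def weight_sum_def)
qed

end

section \<open>Magnitude as a power series\<close>

text \<open>Elimination by the Schur complement of the pivot \<open>K e e\<close>, which is a unit at \<open>0\<close>;
  denominators are avoided by multiplying with the pivot.\<close>

lemma solve_linear_system:
  fixes K :: "'v \<Rightarrow> 'v \<Rightarrow> rat poly"
  assumes "finite V" "\<And>u v. u \<in> V \<Longrightarrow> v \<in> V \<Longrightarrow> poly (K u v) 0 = of_bool (u = v)"
  shows "\<exists>x d. poly d 0 \<noteq> 0 \<and> (\<forall>u\<in>V. (\<Sum>t\<in>V. K u t * x t) = d * b u)"
  using assms
proof (induction V arbitrary: K b rule: finite_induct)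
  case empty
  then show ?case by (intro exI[of _ "\<lambda>_. 0"] exI[of _ 1]) simp
next
  case (insert e V)
  let ?p = "K e e"
  have K: "poly (K u v) 0 = of_bool (u = v)" if "u \<in> insert e V" "v \<in> insert e V" for u v
    using insert.prems that by blast
  have "\<exists>x d. poly d 0 \<noteq> 0 \<and> (\<forall>u\<in>V. (\<Sum>t\<in>V. (?p * K u t - K u e * K e t) * x t) =
      d * (?p * b u - K u e * b e))"
    by (rule insert.IH) (use insert.hyps in \<open>auto simp: K\<close>)
  then obtain x d where d: "poly d 0 \<noteq> 0"
    and x: "\<And>u. u \<in> V \<Longrightarrow> (\<Sum>t\<in>V. (?p * K u t - K u e * K e t) * x t) = d * (?p * b u - K u e * b e)"
    by blast
  define y where "y t = (if t = e then d * b e - (\<Sum>t\<in>V. K e t * x t) else ?p * x t)" for t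
  have sum_y: "(\<Sum>t\<in>insert e V. K u t * y t) =
      K u e * (d * b e - (\<Sum>t\<in>V. K e t * x t)) + ?p * (\<Sum>t\<in>V. K u t * x t)" for u
  proof -
    have "(\<Sum>t\<in>V. K u t * y t) = (\<Sum>t\<in>V. ?p * (K u t * x t))"
      using insert.hyps by (intro sum.cong) (auto simp: y_def mult_ac)
    then show ?thesis using insert.hyps by (simp add: y_def sum_distrib_left)
  qed
  have "(\<Sum>t\<in>insert e V. K u t * y t) = (?p * d) * b u" if "u \<in> insert e V" for u
  proof (cases "u = e")
    case True
    then show ?thesis unfolding sum_y by (simp add: algebra_simps)
  next
    case False
    then have "u \<in> V" using that by simp
    from x[OF this] have "?p * (\<Sum>t\<in>V. K u t * x t) - K u e * (\<Sum>t\<in>V. K e t * x t) =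
        d * (?p * b u - K u e * b e)"
      by (simp add: left_diff_distrib sum_subtractf sum_distrib_left mult.assoc)
    then show ?thesis unfolding sum_y by (simp add: algebra_simps)
  qed
  moreover have "poly (?p * d) 0 \<noteq> 0" using d K by simp
  ultimately show ?case by blast
qed

section \<open>Matrix inverses and weightings\<close>

lemma is_inverse_on_unique:
  assumes "finite V" "is_inverse_on V K N" "is_inverse_on V K N'"
  shows "N = N'"
proof (intro ext)
  fix u v
  show "N u v = N' u v"
  proof (cases "u \<in> V \<and> v \<in> V")
    case True
    have "N u v = (\<Sum>t\<in>V. N u t * (\<Sum>s\<in>V. K t s * N' s v))"
    proof -
      have "(\<Sum>t\<in>V. N u t * (\<Sum>s\<in>V. K t s * N' s v)) = (\<Sum>t\<in>V. N u t * of_bool (t = v))"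
        using assms(3) True by (intro sum.cong) (auto simp: is_inverse_on_def)
      then show ?thesis using sum_of_bool_eq[OF assms(1), of v "N u"] True by simp
    qed
    also have "\<dots> = (\<Sum>s\<in>V. (\<Sum>t\<in>V. N u t * K t s) * N' s v)"
      unfolding sum_distrib_left sum_distrib_right by (subst sum.swap) (simp add: mult.assoc)
    also have "\<dots> = (\<Sum>s\<in>V. N' s v * of_bool (s = u))"
      using assms(2) True by (intro sum.cong) (auto simp: is_inverse_on_def)
    also have "\<dots> = N' u v" using True by (intro sum_of_bool_eq[OF assms(1)]) simp
    finally show ?thesis .
  qed (use assms in \<open>auto simp: is_inverse_on_def\<close>)
qed

text \<open>A right inverse suffices: if \<open>K\<close> is symmetric and \<open>K N = 1\<close>,
  then \<open>N = (K N)\<^sup>T N = N\<^sup>T K N = N\<^sup>T\<close>, and transposing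
  \<open>K N = 1\<close> gives \<open>N K = 1\<close>.\<close>

lemma is_inverse_on_symmetric:
  assumes V: "finite V" and sym: "\<And>u v. u \<in> V \<Longrightarrow> v \<in> V \<Longrightarrow> K u v = K v u"
    and out: "\<And>u v. u \<notin> V \<or> v \<notin> V \<Longrightarrow> N u v = 0"
    and right: "\<And>u v. u \<in> V \<Longrightarrow> v \<in> V \<Longrightarrow> (\<Sum>t\<in>V. K u t * N t v) = of_bool (u = v)"
  shows "is_inverse_on V K N"
proof -
  have N_sym: "N u v = N v u" if u: "u \<in> V" and v: "v \<in> V" for u v
  proof -
    have "N u v = (\<Sum>s\<in>V. N s v * of_bool (s = u))"
      by (rule sum_of_bool_eq[OF V u, symmetric])
    also have "\<dots> = (\<Sum>s\<in>V. (\<Sum>t\<in>V. K s t * N t u) * N s v)"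
      using u by (intro sum.cong) (auto simp: right)
    also have "\<dots> = (\<Sum>t\<in>V. \<Sum>s\<in>V. K s t * N t u * N s v)"
      unfolding sum_distrib_right by (rule sum.swap)
    also have "\<dots> = (\<Sum>t\<in>V. N t u * (\<Sum>s\<in>V. K t s * N s v))"
      unfolding sum_distrib_left using sym by (intro sum.cong refl) (simp add: mult_ac)
    also have "\<dots> = (\<Sum>t\<in>V. N t u * of_bool (t = v))"
      using v by (intro sum.cong) (auto simp: right)
    also have "\<dots> = N v u" by (rule sum_of_bool_eq[OF V v])
    finally show ?thesis .
  qed
  have "(\<Sum>t\<in>V. N u t * K t v) = of_bool (u = v)" if "u \<in> V" "v \<in> V" for u v
  proof -
    have "(\<Sum>t\<in>V. N u t * K t v) = (\<Sum>t\<in>V. K v t * N t u)"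
      using that sym N_sym by (intro sum.cong refl) (metis mult.commute)
    then show ?thesis using right[OF that(2,1)] by (simp add: eq_commute[of u])
  qed
  then show ?thesis using right out by (simp add: is_inverse_on_def of_bool_def)
qed

text \<open>Applying \<open>N\<close> to the equation for \<open>y\<close> turns the all-ones vector
  into \<open>y\<close>, so any weighting computes the magnitude.\<close>

lemma magnitude_eq_sum:
  assumes V: "finite V" and N: "is_inverse_on V (magnitude_matrix R) N"
    and y: "\<And>u. u \<in> V \<Longrightarrow> (\<Sum>t\<in>V. magnitude_matrix R u t * y t) = 1"
  shows "magnitude V R = (\<Sum>u\<in>V. y u)"
proof -
  let ?K = "magnitude_matrix R"
  have "inverse_on V ?K = N"
    unfolding inverse_on_def using N is_inverse_on_unique[OF V] by blast
  then have "magnitude V R = (\<Sum>u\<in>V. \<Sum>v\<in>V. N u v * (\<Sum>t\<in>V. ?K v t * y t))"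
    unfolding magnitude_def by (simp add: y)
  also have "\<dots> = (\<Sum>u\<in>V. y u)"
  proof (rule sum.cong[OF refl])
    fix u assume u: "u \<in> V"
    have "(\<Sum>v\<in>V. N u v * (\<Sum>t\<in>V. ?K v t * y t)) = (\<Sum>t\<in>V. (\<Sum>v\<in>V. N u v * ?K v t) * y t)"
      unfolding sum_distrib_left sum_distrib_right by (subst sum.swap) (simp add: mult.assoc)
    also have "\<dots> = (\<Sum>t\<in>V. y t * of_bool (t = u))"
      using N u by (intro sum.cong) (auto simp: is_inverse_on_def)
    finally show "(\<Sum>v\<in>V. N u v * (\<Sum>t\<in>V. ?K v t * y t)) = y u"
      using sum_of_bool_eq[OF V u] by simp
  qed
  finally show ?thesis .
qed

section \<open>Rational functions regular at 0 and their expansions\<close>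

lemma to_fract_sum: "to_fract (\<Sum>x\<in>A. f x) = (\<Sum>x\<in>A. to_fract (f x))"
  by (induction A rule: infinite_finite_induct) simp_all

lemma to_fract_power: "to_fract (x ^ n) = to_fract x ^ n"
  by (induction n) simp_all

text \<open>The denominator in lowest terms divides \<open>d\<close>, hence does not vanish at 0
  either. The multiplied form of the second claim allows work with an unreduced fraction.\<close>

lemma regular_expansion:
  assumes F: "F = to_fract p / to_fract d" and d: "poly d 0 \<noteq> 0"
  shows "regular_at_0 F" "ratfun_expansion F * fps_of_poly d = fps_of_poly p"
proof -
  define a b where "a = fst (quot_of_fract F)" and "b = snd (quot_of_fract F)"
  have b0: "b \<noteq> 0" by (simp add: b_def)
  have "d \<noteq> 0" using d by auto
  moreover have "Fract a b = Fract p d" using F by (simp add: a_def b_def Fract_conv_to_fract[of p])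
  ultimately have eq: "a * d = p * b" using b0 by (simp add: eq_fract)
  have "coprime b a" using coprime_quot_of_fract[of F] by (simp add: a_def b_def coprime_commute)
  moreover have "b dvd a * d" by (simp add: eq)
  ultimately have "b dvd d" by (simp add: coprime_dvd_mult_right_iff)
  then have b: "poly b 0 \<noteq> 0" using d by auto
  then show "regular_at_0 F" by (simp add: regular_at_0_def b_def)
  have nth: "fps_nth (fps_of_poly b) 0 \<noteq> 0" using b by (simp add: poly_0_coeff_0)
  have "ratfun_expansion F * fps_of_poly b = fps_of_poly a"
    unfolding ratfun_expansion_def a_def[symmetric] b_def[symmetric]
    using nth by (simp add: fps_divide_unit mult.assoc inverse_mult_eq_1)
  then have "(ratfun_expansion F * fps_of_poly d) * fps_of_poly b = fps_of_poly p * fps_of_poly b"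
    by (metis eq fps_of_poly_mult mult.assoc mult.commute)
  moreover have "fps_of_poly b \<noteq> 0" using nth by auto
  ultimately show "ratfun_expansion F * fps_of_poly d = fps_of_poly p" by simp
qed

text \<open>Equal expansions give equal cross products as power series, hence as polynomials, so the
  definite description picks out \<open>F\<close>.\<close>

lemma ratfun_of_expansion:
  assumes "regular_at_0 F"
  shows "ratfun_of_fps (ratfun_expansion F) = F"
  unfolding ratfun_of_fps_def
proof (rule the_equality)
  show "regular_at_0 F \<and> ratfun_expansion F = ratfun_expansion F" using assms by simp
  fix G assume G: "regular_at_0 G \<and> ratfun_expansion G = ratfun_expansion F"
  define a b where "a = fst (quot_of_fract F)" and "b = snd (quot_of_fract F)"
  have F_eq: "F = to_fract a / to_fract b"
    using Fract_quot_of_fract[of F] by (simp add: Fract_conv_to_fract a_def b_def)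
  define a' b' where "a' = fst (quot_of_fract G)" and "b' = snd (quot_of_fract G)"
  have G_eq: "G = to_fract a' / to_fract b'"
    using Fract_quot_of_fract[of G] by (simp add: Fract_conv_to_fract a'_def b'_def)
  have b: "poly b 0 \<noteq> 0" "poly b' 0 \<noteq> 0"
    using assms G by (simp_all add: regular_at_0_def b_def b'_def)
  have "fps_of_poly a * fps_of_poly b' = fps_of_poly a' * fps_of_poly b"
    unfolding regular_expansion(2)[OF F_eq b(1), symmetric]
      regular_expansion(2)[OF G_eq b(2), symmetric] using G by (simp add: mult_ac)
  then have "a * b' = a' * b" by (simp flip: fps_of_poly_mult add: fps_of_poly_eq_iff)
  then have "to_fract a * to_fract b' = to_fract a' * to_fract b" by (metis to_fract_mult)
  moreover have "to_fract b \<noteq> 0" "to_fract b' \<noteq> 0" using b by auto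
  ultimately show "G = F" unfolding F_eq G_eq by (simp add: frac_eq_eq)
qed

text \<open>The weighting \<open>v\<close> consists of power series, so it is compared with a
  solution over the polynomials, \<open>x\<close> with denominator \<open>d\<close>. Evaluating the
  pairing of \<open>x\<close> and \<open>v\<close> through the symmetric matrix in both orders shows
  that the sum of \<open>x\<close> is \<open>d\<close> times the sum of \<open>v\<close>.\<close>

lemma magnitude_expansion:
  assumes V: "finite V"
    and sym: "\<And>u v. u \<in> V \<Longrightarrow> v \<in> V \<Longrightarrow> graph_dist R u v = graph_dist R v u"
    and dist_0: "\<And>u v. u \<in> V \<Longrightarrow> v \<in> V \<Longrightarrow> graph_dist R u v = 0 \<longleftrightarrow> u = v"
    and v: "\<And>u. u \<in> V \<Longrightarrow> (\<Sum>t\<in>V. fps_X ^ graph_dist R u t * v t) = 1"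
  shows "regular_at_0 (magnitude V R)" "ratfun_expansion (magnitude V R) = (\<Sum>u\<in>V. v u)"
proof -
  define P where "P u t = [:0, 1 :: rat:] ^ graph_dist R u t" for u t
  have K: "magnitude_matrix R u t = to_fract (P u t)" for u t
    unfolding magnitude_matrix_def P_def to_fract_power by (simp add: ratfun_q_def to_fract_def)
  \<comment> \<open>At \<open>q = 0\<close> only pairs at distance 0 survive, so the matrix becomes
    the identity, as \<open>solve_linear_system\<close> requires.\<close>
  have P0: "poly (P u t) 0 = of_bool (u = t)" if "u \<in> V" "t \<in> V" for u t
    using dist_0[OF that] by (simp add: P_def power_0_left)
  note solve = solve_linear_system[OF V P0]
  \<comment> \<open>The columns of the inverse are the solutions for the unit vectors.\<close>
  have "\<forall>w. \<exists>x. (\<forall>u\<in>V. (\<Sum>t\<in>V. to_fract (P u t) * x t) = of_bool (u = w))"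
  proof
    fix w
    obtain x d where d: "poly d 0 \<noteq> 0"
      and x: "\<And>u. u \<in> V \<Longrightarrow> (\<Sum>t\<in>V. P u t * x t) = d * of_bool (u = w)"
      using solve[of "\<lambda>u. of_bool (u = w)"] by blast
    have dn: "to_fract d \<noteq> 0" using d by auto
    have "(\<Sum>t\<in>V. to_fract (P u t) * (to_fract (x t) / to_fract d)) = of_bool (u = w)" if "u \<in> V" for u
    proof -
      have "(\<Sum>t\<in>V. to_fract (P u t) * (to_fract (x t) / to_fract d)) =
          to_fract (\<Sum>t\<in>V. P u t * x t) / to_fract d"
        by (simp add: to_fract_sum sum_divide_distrib)
      then show ?thesis unfolding x[OF that] using dn by simp
    qed
    then show "\<exists>x. (\<forall>u\<in>V. (\<Sum>t\<in>V. to_fract (P u t) * x t) = of_bool (u = w))"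
      by (intro exI[of _ "\<lambda>t. to_fract (x t) / to_fract d"] ballI)
  qed
  from choice[OF this] obtain M
    where M: "\<forall>w. \<forall>u\<in>V. (\<Sum>t\<in>V. to_fract (P u t) * M w t) = of_bool (u = w)" ..
  have inv: "is_inverse_on V (magnitude_matrix R) (\<lambda>t w. if t \<in> V \<and> w \<in> V then M w t else 0)"
    (is "is_inverse_on V _ ?N")
  proof (rule is_inverse_on_symmetric[OF V])
    show "magnitude_matrix R u w = magnitude_matrix R w u" if "u \<in> V" "w \<in> V" for u w
      using sym[OF that] by (simp add: magnitude_matrix_def)
    show "(\<Sum>t\<in>V. magnitude_matrix R u t * ?N t w) = of_bool (u = w)" if "u \<in> V" "w \<in> V" for u w
    proof -
      have "(\<Sum>t\<in>V. magnitude_matrix R u t * ?N t w) = (\<Sum>t\<in>V. to_fract (P u t) * M w t)"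
        using that by (intro sum.cong) (simp_all add: K)
      then show ?thesis using M that by simp
    qed
  qed auto
  obtain x d where d: "poly d 0 \<noteq> 0"
    and x: "\<And>u. u \<in> V \<Longrightarrow> (\<Sum>t\<in>V. P u t * x t) = d"
    using solve[of "\<lambda>_. 1"] by auto
  have dn: "to_fract d \<noteq> 0" using d by auto
  have "magnitude V R = (\<Sum>u\<in>V. to_fract (x u) / to_fract d)"
  proof (rule magnitude_eq_sum[OF V inv])
    fix u assume u: "u \<in> V"
    have "(\<Sum>t\<in>V. magnitude_matrix R u t * (to_fract (x t) / to_fract d)) =
        to_fract (\<Sum>t\<in>V. P u t * x t) / to_fract d"
      by (simp add: K to_fract_sum sum_divide_distrib)
    then show "(\<Sum>t\<in>V. magnitude_matrix R u t * (to_fract (x t) / to_fract d)) = 1"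
      using x[OF u] dn by simp
  qed
  then have mag: "magnitude V R = to_fract (\<Sum>u\<in>V. x u) / to_fract d"
    by (simp add: to_fract_sum sum_divide_distrib)
  show "regular_at_0 (magnitude V R)" by (rule regular_expansion(1)[OF mag d])
  have fps_P: "fps_of_poly (P u t) = fps_X ^ graph_dist R u t" for u t
    by (simp add: P_def fps_of_poly_power fps_of_poly_fps_X)
  have "fps_of_poly (\<Sum>u\<in>V. x u) = (\<Sum>t\<in>V. fps_of_poly (x t) * (\<Sum>u\<in>V. fps_of_poly (P t u) * v u))"
    by (simp add: fps_P v fps_of_poly_sum)
  also have "\<dots> = (\<Sum>u\<in>V. \<Sum>t\<in>V. fps_of_poly (x t) * (fps_of_poly (P t u) * v u))"
    unfolding sum_distrib_left by (rule sum.swap)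
  also have "\<dots> = (\<Sum>u\<in>V. v u * fps_of_poly (\<Sum>t\<in>V. P u t * x t))"
    unfolding fps_of_poly_sum fps_of_poly_mult sum_distrib_left
    by (intro sum.cong refl) (simp add: fps_P sym mult_ac)
  also have "\<dots> = (\<Sum>u\<in>V. v u) * fps_of_poly d"
    unfolding sum_distrib_right by (intro sum.cong refl) (simp add: x)
  finally have "ratfun_expansion (magnitude V R) * fps_of_poly d = (\<Sum>u\<in>V. v u) * fps_of_poly d"
    using regular_expansion(2)[OF mag d] by simp
  moreover have "fps_of_poly d \<noteq> 0" using d by (auto simp: fps_of_poly_eq_iff[of d 0, simplified])
  ultimately show "ratfun_expansion (magnitude V R) = (\<Sum>u\<in>V. v u)" by simp
qed

section \<open>The tope graph\<close>

lemma separation_commute: "separation X Y = separation Y X"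
proof -
  have "X e = - Y e \<and> X e \<noteq> 0 \<longleftrightarrow> Y e = - X e \<and> Y e \<noteq> 0" for e by linarith
  then show ?thesis unfolding separation_def by (rule Collect_cong)
qed

context oriented_matroid
begin

lemma covector_outside: "X \<in> L \<Longrightarrow> e \<notin> E \<Longrightarrow> X e = 0"
  using restrictions_outside[of X E e] restrictions_ground by simp

lemma restricted_topes_ground: "restricted_topes E = {B \<in> L. \<forall>e\<in>E. B e \<noteq> 0}"
  by (simp add: restricted_topes_def restrictions_ground)

text \<open>A covector that vanishes at \<open>e\<close> becomes strictly larger when composed with
  one that does not, so maximal covectors have no zero on \<open>E\<close>.\<close>

lemma topes_eq:
  assumes "\<And>e. e \<in> E \<Longrightarrow> \<exists>Y\<in>L. Y e \<noteq> 0"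
  shows "topes L = restricted_topes E"
proof (intro set_eqI iffI)
  fix X assume X: "X \<in> topes L"
  have "X e \<noteq> 0" if eE: "e \<in> E" for e
  proof
    assume "X e = 0"
    obtain Y where Y: "Y \<in> L" "Y e \<noteq> 0" using assms[OF eE] by blast
    have "covector_le X (sign_comp X Y)" by (simp add: covector_le_def sign_comp_def)
    then have "sign_comp X Y = X" using X comp_covector Y(1) by (auto simp: topes_def)
    then have "sign_comp X Y e = X e" by simp
    then show False using \<open>X e = 0\<close> Y(2) by (simp add: sign_comp_def)
  qed
  then show "X \<in> restricted_topes E" using X by (simp add: restricted_topes_ground topes_def)
next
  fix X assume X: "X \<in> restricted_topes E"
  have "Y = X" if Y: "Y \<in> L" "covector_le X Y" for Y
  proof
    fix e
    have "X e = 0 \<or> X e = Y e" using Y(2) by (auto simp: covector_le_def)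
    moreover have "e \<in> E \<Longrightarrow> X e \<noteq> 0" "e \<notin> E \<Longrightarrow> X e = 0 \<and> Y e = 0"
      using X Y(1) covector_outside by (auto simp: restricted_topes_ground)
    ultimately show "Y e = X e" by (cases "e \<in> E") simp_all
  qed
  then show "X \<in> topes L" using X by (auto simp: topes_def restricted_topes_ground)
qed

lemma finite_separation: "X \<in> L \<Longrightarrow> finite (separation X Y)"
  using covector_outside by (auto intro!: finite_subset[OF _ finite_ground] simp: separation_def)

lemma tope_covector_cases:
  assumes "B \<in> restricted_topes E" "X \<in> L" "e \<in> E"
  shows "X e = 0 \<or> X e = B e \<or> e \<in> separation B X"
  using assms sign_cases[of B e] sign_cases[of X e] by (auto simp: restricted_topes_ground separation_def)

lemma tope_leI:
  assumes "B \<in> restricted_topes E" "X \<in> L" "separation B X = {}"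
  shows "covector_le X B"
  unfolding covector_le_def
proof
  fix e show "X e \<in> {0, B e}"
    using tope_covector_cases[OF assms(1,2), of e] assms(3) covector_outside[OF assms(2), of e] by auto
qed

text \<open>Eliminating a separating element between \<open>B\<close> and \<open>W\<close> gives a
  covector that agrees with \<open>B\<close> off the separation set and is separated from
  \<open>B\<close> at fewer elements. Repeating this until nothing separates yields a proper face of
  \<open>B\<close>.\<close>

lemma ex_proper_face:
  assumes B: "B \<in> restricted_topes E" and W: "W \<in> L" "separation B W \<noteq> {}"
  shows "\<exists>Z\<in>L. covector_le Z B \<and> zero_set E Z \<noteq> {} \<and> zero_set E Z \<subseteq> separation B W"
  using W
proof (induction "card (separation B W)" arbitrary: W rule: less_induct)
  case less
  have BL: "B \<in> L" "\<And>e. e \<in> E \<Longrightarrow> B e \<noteq> 0" using B by (auto simp: restricted_topes_ground)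
  obtain e where e: "e \<in> separation B W" using less.prems by blast
  obtain Z where Z: "Z \<in> L" "Z e = 0" "\<forall>f\<in>E - separation B W. Z f = sign_comp B W f"
    using elimination[OF BL(1) less.prems(1) e] by blast
  have eE: "e \<in> E" using e covector_outside[OF BL(1)] by (auto simp: separation_def)
  have ZB: "Z f = B f" if "f \<in> E" "f \<notin> separation B W" for f
    using Z(3) that BL(2) by (simp add: sign_comp_def)
  have sub: "separation B Z \<subseteq> separation B W - {e}"
  proof
    fix f assume f: "f \<in> separation B Z"
    then have "f \<in> E" using covector_outside[OF BL(1)] by (auto simp: separation_def)
    moreover have "f \<noteq> e" using f Z(2) by (auto simp: separation_def)
    moreover have "Z f \<noteq> B f" using f by (auto simp: separation_def)
    ultimately show "f \<in> separation B W - {e}" using ZB by blast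
  qed
  show ?case
  proof (cases "separation B Z = {}")
    case True
    have "zero_set E Z \<subseteq> separation B W"
    proof
      fix f assume "f \<in> zero_set E Z"
      then have f: "f \<in> E" "Z f = 0" by (auto simp: zero_set_def)
      then show "f \<in> separation B W" using ZB[OF f(1)] BL(2)[OF f(1)] by auto
    qed
    moreover have "e \<in> zero_set E Z" using eE Z(2) by (simp add: zero_set_def)
    ultimately show ?thesis using tope_leI[OF B Z(1) True] Z(1) by blast
  next
    case False
    have "card (separation B Z) < card (separation B W)"
      using sub e by (intro psubset_card_mono finite_separation BL) blast
    from less.hyps[OF this Z(1) False] show ?thesis using sub by blast
  qed
qed

text \<open>If the zero set of \<open>X\<close> contained distinct \<open>e\<close> and
  \<open>f\<close>, take a covector that vanishes at \<open>e\<close> and is opposite to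
  \<open>B\<close> at \<open>f\<close>. Composing \<open>X\<close> with it and applying
  \<open>ex_proper_face\<close> gives a face strictly between \<open>X\<close> and
  \<open>B\<close>.\<close>

lemma tope_cover_singleton:
  assumes simple: "\<And>e f. e \<in> E \<Longrightarrow> f \<in> E \<Longrightarrow> e \<noteq> f \<Longrightarrow> \<exists>Y\<in>L. Y e = 0 \<and> Y f \<noteq> 0"
    and B: "B \<in> restricted_topes E" and cover: "covector_covers L B X"
  shows "\<exists>e\<in>E. zero_set E X = {e}"
proof -
  have BL: "B \<in> L" "\<And>e. e \<in> E \<Longrightarrow> B e \<noteq> 0" using B by (auto simp: restricted_topes_ground)
  have X: "X \<in> L" "X \<noteq> B" "\<And>e. X e = 0 \<or> X e = B e"
    and no_between: "\<And>Z. Z \<in> L \<Longrightarrow> covector_le X Z \<Longrightarrow> covector_le Z B \<Longrightarrow> Z = X \<or> Z = B"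
    using cover by (auto simp: covector_covers_def covector_le_def)
  obtain e where "X e \<noteq> B e" using X(2) by (auto simp: fun_eq_iff)
  then have e: "e \<in> E" "X e = 0"
    using X(3)[of e] covector_outside[OF X(1), of e] covector_outside[OF BL(1), of e] by auto
  have "f = e" if f: "f \<in> E" "X f = 0" for f
  proof (rule ccontr)
    assume "f \<noteq> e"
    then obtain Y where Y: "Y \<in> L" "Y e = 0" "Y f \<noteq> 0" using simple[of e f] e f by auto
    obtain Y' where Y': "Y' \<in> L" "Y' e = 0" "Y' f = - B f"
    proof (cases "Y f = B f")
      case True
      then show ?thesis using that[OF uminus_covector[OF Y(1)]] Y by simp
    next
      case False
      then have "Y f = - B f"
        using Y(3) BL(2)[OF f(1)] sign_cases[OF Y(1), of f] sign_cases[OF BL(1), of f] by auto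
      then show ?thesis using that[OF Y(1)] Y by simp
    qed
    define W where "W = sign_comp X Y'"
    have W: "W \<in> L" unfolding W_def by (rule comp_covector[OF X(1) Y'(1)])
    have "f \<in> separation B W"
      using f Y'(3) BL(2)[OF f(1)] by (simp add: separation_def W_def sign_comp_def)
    then obtain Z where Z: "Z \<in> L" "covector_le Z B" "zero_set E Z \<noteq> {}"
      "zero_set E Z \<subseteq> separation B W"
      using ex_proper_face[OF B W] by blast
    \<comment> \<open>\<open>Z\<close> vanishes only where \<open>W\<close> is opposite to
      \<open>B\<close>. At such places \<open>X\<close> vanishes, and \<open>e\<close> is not among
      them because \<open>W e = 0\<close>; hence \<open>Z\<close> lies above \<open>X\<close> and
      differs from it at \<open>e\<close>.\<close>
    have "covector_le X Z"
      unfolding covector_le_def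
    proof
      fix g
      show "X g \<in> {0, Z g}"
      proof (cases "X g = 0")
        case False
        then have "X g = B g" "W g = X g" "g \<in> E"
          using X(3)[of g] covector_outside[OF X(1), of g] by (auto simp: W_def sign_comp_def)
        then have "g \<notin> separation B W" using False by (auto simp: separation_def)
        then have "Z g \<noteq> 0" using Z(4) \<open>g \<in> E\<close> by (auto simp: zero_set_def)
        then show ?thesis using Z(2) \<open>X g = B g\<close> by (auto simp: covector_le_def)
      qed simp
    qed
    then have "Z = X \<or> Z = B" using no_between Z by blast
    moreover have "Z \<noteq> B" using Z(3) BL(2) by (auto simp: zero_set_def)
    moreover have "Z \<noteq> X"
    proof
      assume "Z = X"
      then have "e \<in> separation B W" using Z(4) e by (auto simp: zero_set_def)
      then show False using e Y'(2) by (auto simp: separation_def W_def sign_comp_def)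
    qed
    ultimately show False by blast
  qed
  then have "zero_set E X = {e}" using e unfolding zero_set_def by blast
  then show ?thesis using e by blast
qed

lemma covector_covers_facet:
  assumes "B \<in> restricted_topes E" "Z \<in> L" "covector_le Z B" "zero_set E Z = {e}"
  shows "covector_covers L B Z"
  unfolding covector_covers_def
proof (intro conjI ballI impI)
  have BL: "B \<in> L" "\<And>e. e \<in> E \<Longrightarrow> B e \<noteq> 0" using assms by (auto simp: restricted_topes_ground)
  show "B \<in> L" "Z \<in> L" "covector_le Z B" by fact+
  have "e \<in> zero_set E Z" using assms(4) by simp
  then have Ze: "Z e = 0" "e \<in> E" by (simp_all add: zero_set_def)
  then show "Z \<noteq> B" using BL(2) by blast
  fix Y assume Y: "Y \<in> L" "covector_le Z Y \<and> covector_le Y B"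
  have Z: "Z f \<noteq> 0" if "f \<in> E" "f \<noteq> e" for f
  proof -
    have "f \<notin> zero_set E Z" using that assms(4) by blast
    then show ?thesis using that(1) by (simp add: zero_set_def)
  qed
  have Y_cases: "Z f = 0 \<or> Z f = Y f" "Y f = 0 \<or> Y f = B f" for f
    using Y(2) by (auto simp: covector_le_def)
  have off: "Y f = Z f \<and> Y f = B f" if "f \<noteq> e" for f
  proof (cases "f \<in> E")
    case True
    then show ?thesis using Y_cases[of f] Z[OF True that] by auto
  next
    case False
    then show ?thesis using covector_outside[OF _ False] Y(1) assms(2) BL(1) by metis
  qed
  show "Y = Z \<or> Y = B"
  proof (cases "Y e = 0")
    case True
    then have "Y = Z" using off Ze(1) by (metis ext)
    then show ?thesis ..
  next
    case False
    then have "Y = B" using off Y_cases(2)[of e] by (metis ext)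
    then show ?thesis ..
  qed
qed

lemma separation_empty_iff:
  assumes "B \<in> restricted_topes E" "C \<in> restricted_topes E"
  shows "separation B C = {} \<longleftrightarrow> B = C"
proof
  assume s: "separation B C = {}"
  show "B = C"
  proof
    fix e
    have "C \<in> L" "C e \<noteq> 0 \<or> e \<notin> E" "B \<in> L" using assms by (auto simp: restricted_topes_ground)
    then show "B e = C e"
      using s tope_covector_cases[OF assms(1), of C e] covector_outside[of B e] covector_outside[of C e]
      by (cases "e \<in> E") auto
  qed
next
  assume "B = C"
  then show "separation B C = {}" by (auto simp: separation_def)
qed

section \<open>Distances in the tope graph of a simple oriented matroid\<close>

context
  assumes loopless: "\<And>e. e \<in> E \<Longrightarrow> \<exists>Y\<in>L. Y e \<noteq> 0"
    and parallel_free: "\<And>e f. e \<in> E \<Longrightarrow> f \<in> E \<Longrightarrow> e \<noteq> f \<Longrightarrow> \<exists>Y\<in>L. Y e = 0 \<and> Y f \<noteq> 0"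
begin

text \<open>Adjacent topes cover a common covector whose zero set is a single element, and both
  agree with it elsewhere.\<close>

lemma separation_adjacent:
  assumes "(B, B') \<in> tope_adjacency L"
  shows "\<exists>e. separation B C \<subseteq> insert e (separation B' C)"
proof -
  obtain X where B: "B \<in> restricted_topes E" "B' \<in> restricted_topes E" and X: "covector_covers L B X" "covector_covers L B' X"
    using assms by (auto simp: tope_adjacency_def topes_eq[OF loopless])
  obtain e where e: "zero_set E X = {e}" using tope_cover_singleton[OF parallel_free B(1) X(1)] by blast
  have "B f = B' f" if "f \<noteq> e" for f
  proof (cases "f \<in> E")
    case True
    then have "f \<notin> zero_set E X" using e that by blast
    then have "X f \<noteq> 0" using True by (simp add: zero_set_def)
    moreover have "X f = 0 \<or> X f = B f" "X f = 0 \<or> X f = B' f"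
      using X by (auto simp: covector_covers_def covector_le_def)
    ultimately show ?thesis by auto
  next
    case False
    have "B \<in> L" "B' \<in> L" using B by (simp_all add: restricted_topes_ground)
    then show ?thesis using covector_outside[OF _ False] by metis
  qed
  then have "separation B C \<subseteq> insert e (separation B' C)" by (auto simp: separation_def)
  then show ?thesis by blast
qed

text \<open>Among the faces of \<open>B\<close> whose nonempty zero set lies in the separation from
  \<open>C\<close>, one with the smallest zero set is covered by \<open>B\<close> and so vanishes at
  a single \<open>e\<close>. Composing it with \<open>C\<close> flips \<open>B\<close> exactly at
  \<open>e\<close>.\<close>

lemma ex_adjacent_closer:
  assumes B: "B \<in> restricted_topes E" and C: "C \<in> restricted_topes E" and "B \<noteq> C"
  shows "\<exists>B'\<in>restricted_topes E. (B, B') \<in> tope_adjacency L \<and>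
    card (separation B C) = Suc (card (separation B' C))"
proof -
  have BL: "B \<in> L" "\<And>e. e \<in> E \<Longrightarrow> B e \<noteq> 0" and CL: "C \<in> L" "\<And>e. e \<in> E \<Longrightarrow> C e \<noteq> 0"
    using B C by (auto simp: restricted_topes_ground)
  define Q where "Q Z \<longleftrightarrow> Z \<in> L \<and> covector_le Z B \<and> zero_set E Z \<noteq> {} \<and>
    zero_set E Z \<subseteq> separation B C" for Z
  have "separation B C \<noteq> {}" using separation_empty_iff[OF B C] assms(3) by simp
  then have "\<exists>Z. Q Z" using ex_proper_face[OF B CL(1)] by (auto simp: Q_def)
  then obtain Z where Z: "Q Z" and min: "\<And>Z'. Q Z' \<Longrightarrow> card (zero_set E Z) \<le> card (zero_set E Z')"
    using ex_has_least_nat[of Q _ "\<lambda>Z. card (zero_set E Z)"] by blast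
  have ZL: "Z \<in> L" "\<And>e. Z e = 0 \<or> Z e = B e" "covector_le Z B"
    using Z by (auto simp: Q_def covector_le_def)
  have "covector_covers L B Z"
    unfolding covector_covers_def
  proof (intro conjI ballI impI ZL(1) BL(1) ZL(3))
    show "Z \<noteq> B" using Z BL(2) by (auto simp: Q_def zero_set_def)
    fix Y assume Y: "Y \<in> L" "covector_le Z Y \<and> covector_le Y B"
    then have le: "Z e = 0 \<or> Z e = Y e" "Y e = 0 \<or> Y e = B e" for e by (auto simp: covector_le_def)
    have sub: "zero_set E Y \<subseteq> zero_set E Z" using le(1) by (force simp: zero_set_def)
    \<comment> \<open>A face between \<open>Z\<close> and \<open>B\<close> either has no zero on
      \<open>E\<close>, and then is \<open>B\<close>, or competes with \<open>Z\<close> for the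
      smallest zero set.\<close>
    show "Y = Z \<or> Y = B"
    proof (cases "zero_set E Y = {}")
      case True
      have "Y e = B e" for e
        using True le(2)[of e] covector_outside[OF Y(1), of e] covector_outside[OF BL(1), of e]
        by (cases "e \<in> E") (auto simp: zero_set_def)
      then show ?thesis by blast
    next
      case False
      then have "Q Y" using Y sub Z by (auto simp: Q_def)
      moreover have "finite (zero_set E Z)" using finite_ground by (simp add: zero_set_def)
      ultimately have eq: "zero_set E Y = zero_set E Z" using min sub card_seteq by blast
      have "Y e = Z e" for e
      proof (cases "e \<in> E")
        case True
        have "e \<in> zero_set E Y \<longleftrightarrow> e \<in> zero_set E Z" using eq by simp
        then show ?thesis using True le(1)[of e] by (auto simp: zero_set_def)
      qed (metis Y(1) ZL(1) covector_outside)
      then show ?thesis by blast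
    qed
  qed
  note coverB = this
  from tope_cover_singleton[OF parallel_free B coverB] obtain e
    where e: "e \<in> E" "zero_set E Z = {e}" by blast
  have eS: "e \<in> separation B C" using Z e by (auto simp: Q_def)
  have Ze: "Z e = 0" using e by (auto simp: zero_set_def)
  have Zf: "Z f = B f" if "f \<noteq> e" for f
  proof (cases "f \<in> E")
    case True
    then have "f \<notin> zero_set E Z" using e that by blast
    then show ?thesis using ZL(2)[of f] True by (auto simp: zero_set_def)
  qed (metis BL(1) ZL(1) covector_outside)
  define B' where "B' = sign_comp Z C"
  have B'_e: "B' e = C e" using Ze by (simp add: B'_def sign_comp_def)
  have B'_f: "B' f = B f" if "f \<noteq> e" for f
    using Zf[OF that] BL covector_outside[OF BL(1), of f] covector_outside[OF CL(1), of f]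
    by (cases "f \<in> E") (simp_all add: B'_def sign_comp_def)
  have B': "B' \<in> restricted_topes E"
  proof -
    have "B' f \<noteq> 0" if "f \<in> E" for f
      using B'_e B'_f BL(2) CL(2) that by (cases "f = e") simp_all
    moreover have "B' \<in> L" unfolding B'_def by (rule comp_covector[OF ZL(1) CL(1)])
    ultimately show ?thesis by (simp add: restricted_topes_ground)
  qed
  have "covector_le Z B'" by (simp add: covector_le_def B'_def sign_comp_def)
  then have "covector_covers L B' Z" by (rule covector_covers_facet[OF B' ZL(1) _ e(2)])
  moreover have "B \<noteq> B'"
  proof
    assume "B = B'"
    then have "B e = C e" using B'_e by simp
    then show False using eS by (auto simp: separation_def)
  qed
  ultimately have "(B, B') \<in> tope_adjacency L"
    using B B' coverB ZL(1) by (auto simp: tope_adjacency_def topes_eq[OF loopless])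
  moreover have "separation B C = insert e (separation B' C)" "e \<notin> separation B' C"
  proof -
    show en: "e \<notin> separation B' C" using B'_e by (auto simp: separation_def)
    have off: "f \<in> separation B C \<longleftrightarrow> f \<in> separation B' C" if "f \<noteq> e" for f
      using B'_f[OF that] by (simp add: separation_def)
    show "separation B C = insert e (separation B' C)"
    proof (rule set_eqI)
      fix f show "f \<in> separation B C \<longleftrightarrow> f \<in> insert e (separation B' C)"
        using eS off[of f] by (cases "f = e") simp_all
    qed
  qed
  moreover have "finite (separation B' C)" using B' by (auto simp: restricted_topes_ground intro: finite_separation)
  ultimately show ?thesis using B' by (metis card_insert_disjoint)
qed

text \<open>\<open>ex_adjacent_closer\<close> provides a path of this length, and by
  \<open>separation_adjacent\<close> each step of any path removes at most one separating
  element.\<close>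

lemma tope_graph_dist:
  assumes "B \<in> restricted_topes E" "C \<in> restricted_topes E"
  shows "graph_dist (tope_adjacency L) B C = card (separation B C)"
  unfolding graph_dist_def
proof (rule Least_equality)
  show "(B, C) \<in> tope_adjacency L ^^ card (separation B C)"
    using assms
  proof (induction "card (separation B C)" arbitrary: B)
    case 0
    then have "separation B C = {}" using finite_separation[of B] by (auto simp: restricted_topes_ground)
    then show ?case using separation_empty_iff[OF 0(2,3)] by simp
  next
    case (Suc n)
    have "B \<noteq> C"
    proof
      assume "B = C"
      then have "separation B C = {}" using separation_empty_iff Suc.prems by blast
      then show False using Suc(2) by simp
    qed
    then obtain B' where B': "B' \<in> restricted_topes E" "(B, B') \<in> tope_adjacency L"
      "card (separation B C) = Suc (card (separation B' C))"
      using ex_adjacent_closer Suc.prems by blast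
    then have "(B', C) \<in> tope_adjacency L ^^ n" using Suc by simp
    then have "(B, C) \<in> tope_adjacency L ^^ Suc n" using B'(2) by (rule relpow_Suc_I2[rotated])
    then show ?case using Suc(2) by simp
  qed
  show "card (separation B C) \<le> n" if "(B, C) \<in> tope_adjacency L ^^ n" for n
    using that
  proof (induction n arbitrary: B)
    case 0
    then show ?case by (auto simp: separation_def)
  next
    case (Suc n)
    then obtain B' where B': "(B, B') \<in> tope_adjacency L" "(B', C) \<in> tope_adjacency L ^^ n"
      by (meson relpow_Suc_D2)
    then have "B' \<in> L" by (simp add: tope_adjacency_def topes_def)
    obtain e where "separation B C \<subseteq> insert e (separation B' C)"
      using separation_adjacent[OF B'(1)] by blast
    then have "card (separation B C) \<le> card (insert e (separation B' C))"
      using finite_separation[OF \<open>B' \<in> L\<close>] by (intro card_mono) simp_all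
    also have "\<dots> \<le> Suc (card (separation B' C))" by (rule card_insert_le_m1) simp_all
    finally show ?case using Suc.IH[OF B'(2)] by simp
  qed
qed

end

lemma simple_imp_loopless:
  assumes "matroid_simple E indep" "e \<in> E"
  shows "\<exists>Y\<in>L. Y e \<noteq> 0"
proof -
  have "{e} \<in> indep" using assms by (auto simp: matroid_simple_def matroid_loop_def)
  then have "e \<notin> cl {}" by (auto simp: indep_def)
  then show ?thesis using assms(2) by (auto simp: cl_def)
qed

lemma simple_imp_parallel_free:
  assumes "matroid_simple E indep" "e \<in> E" "f \<in> E" "e \<noteq> f"
  shows "\<exists>Y\<in>L. Y e = 0 \<and> Y f \<noteq> 0"
proof -
  have "{e, f} \<in> indep" using assms by (auto simp: matroid_simple_def matroid_parallel_def)
  then have "f \<notin> cl ({e, f} - {f})" unfolding indep_def by blast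
  moreover have "{e, f} - {f} = {e}" using assms by blast
  ultimately show ?thesis using assms(2,3) by (auto simp: cl_def zero_set_def)
qed

end

theorem theoremA:
  fixes E :: "'a set" and L :: "('a \<Rightarrow> int) set"
  assumes "oriented_matroid E L"
    and "oriented_matroid_simple E L"
  shows "regular_at_0 (magnitude (topes L) (tope_adjacency L)) \<and>
    ratfun_expansion (magnitude (topes L) (tope_adjacency L)) =
      rat_fps_of_int_fps (motivic_zeta_minus_one E (underlying_matroid E L)) \<and>
    magnitude (topes L) (tope_adjacency L) =
      ratfun_of_fps (rat_fps_of_int_fps (motivic_zeta_minus_one E (underlying_matroid E L)))"
proof -
  interpret oriented_matroid E L by fact
  have simple: "matroid_simple E indep"
    using assms(2) by (simp add: oriented_matroid_simple_def underlying_eq)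
  note loopless = simple_imp_loopless[OF simple]
  have topes: "topes L = restricted_topes E" by (rule topes_eq) (rule loopless)
  have dist: "graph_dist (tope_adjacency L) B C = card (separation B C)"
    if "B \<in> restricted_topes E" "C \<in> restricted_topes E" for B C
    by (rule tope_graph_dist) (fact that loopless simple_imp_parallel_free[OF simple])+
  have "\<exists>v. (\<forall>A\<in>restricted_topes E. (\<Sum>B\<in>restricted_topes E. fps_X ^ card (separation A B) * v B) = 1) \<and>
      (\<Sum>B\<in>restricted_topes E. v B) = zeta E"
    by (rule ex_weighting) (rule zeta_empty, erule zeta_rec, rule subset_refl)
  then obtain v where v: "\<forall>A\<in>restricted_topes E. (\<Sum>B\<in>restricted_topes E. fps_X ^ card (separation A B) * v B) = 1"
    "(\<Sum>B\<in>restricted_topes E. v B) = zeta E" by blast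
  have dist_0: "graph_dist (tope_adjacency L) B C = 0 \<longleftrightarrow> B = C" if "B \<in> restricted_topes E" "C \<in> restricted_topes E" for B C
    using separation_empty_iff[OF that] finite_separation[of B C] that(1)
    by (simp add: dist[OF that] restricted_topes_ground)
  have sym: "graph_dist (tope_adjacency L) B C = graph_dist (tope_adjacency L) C B"
    if "B \<in> restricted_topes E" "C \<in> restricted_topes E" for B C
    unfolding dist[OF that] dist[OF that(2,1)] by (subst separation_commute) (rule refl)
  have weighting: "(\<Sum>B\<in>restricted_topes E. fps_X ^ graph_dist (tope_adjacency L) A B * v B) = 1"
    if "A \<in> restricted_topes E" for A
    using v(1) that by (simp add: dist)
  have expansion: "regular_at_0 (magnitude (restricted_topes E) (tope_adjacency L))"
    "ratfun_expansion (magnitude (restricted_topes E) (tope_adjacency L)) = (\<Sum>B\<in>restricted_topes E. v B)"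
    by (rule magnitude_expansion[where v = v]; fact finite_restricted_topes sym dist_0 weighting)+
  show ?thesis
    unfolding topes underlying_eq motivic_zeta_minus_one_eq v(2)[symmetric]
    using expansion ratfun_of_expansion[OF expansion(1)] by simp
qed

end
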